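(* Let $m_1,\ldots,m_p$ be distinct positive integers, let $\gamma=\min_j m_j$, and for a positive integer $m$ let $\theta_m(x)=1/(x+m)$ for $x\in[0,1]$. For $s>0$ define $L_s:C[0,1]\to C[0,1]$ by $$(L_sv)(x)=\sum_{j=1}^p\big|\theta_{m_j}'(x)\big|^s\,v(\theta_{m_j}(x))=\sum_{j=1}^p (x+m_j)^{-2s}\,v\Big(\frac{1}{x+m_j}\Big).$$ Then for all $s>0$, $L_s$ has a strictly positive eigenvector $v_s$, unique up to positive scalar multiples, with $L_sv_s=\lambda_sv_s$, where $\lambda_s>0$ and $\lambda_s=r(L_s)$ is the spectral radius of $L_s$. The map $s\mapsto\lambda_s$ is strictly decreasing and continuous. For every positive integer $k$, $(-1)^kD^{(k)}v_s(x)>0$ for all $x\in[0,1]$ and $$|D^{(k)}v_s(x)|\le (2s)(2s+1)\cdots(2s+k-1)\,\gamma^{-k}\,v_s(x),\qquad x\in[0,1].$$ Finally, the Hausdorff dimension of the Cantor set $E_{[m_1,\ldots,m_p]}$ is the unique value of $s$ with $\lambda_s=1$.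
   Context: $E_{[m_1,\ldots,m_p]}$ denotes the set of points $x\in[0,1]$ whose continued fraction expansion $x=1/(a_1+1/(a_2+1/(a_3+\cdots)))$ has all coefficients $a_i\in\{m_1,\ldots,m_p\}$; equivalently it is the set of limit points of $\theta_{a_1}\circ\cdots\circ\theta_{a_n}(0)$ with all $a_i\in\{m_1,\ldots,m_p\}$. $D^{(k)}$ denotes the $k$-th derivative.
   Formalization: The final claim on the Hausdorff dimension is stated for p ≥ 2 only: for p = 1 the set E is a single point of dimension 0 and λ_s < 1 for all s > 0, so no s > 0 has λ_s = 1. *)

theory Defs
  imports "HOL-Analysis.Analysis"
begin

definition theta :: "nat \<Rightarrow> real \<Rightarrow> real" where
  "theta m x = 1 / (x + real m)"

text \<open>The operator L_s on real-valued functions (only values on [0,1] matter).\<close>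
definition Lop :: "nat set \<Rightarrow> real \<Rightarrow> (real \<Rightarrow> real) \<Rightarrow> real \<Rightarrow> real" where
  "Lop M s v x = (\<Sum>m\<in>M. (x + real m) powr (-2 * s) * v (theta m x))"

definition Lop_c :: "nat set \<Rightarrow> real \<Rightarrow> (real \<Rightarrow> complex) \<Rightarrow> real \<Rightarrow> complex" where
  "Lop_c M s f x = (\<Sum>m\<in>M. complex_of_real ((x + real m) powr (-2 * s)) * f (theta m x))"

text \<open>mu is in the resolvent set iff L_s - mu I is a bijection of C([0,1],complex)
  (bounded inverse is automatic by the open mapping theorem).\<close>
definition spectrum_L :: "nat set \<Rightarrow> real \<Rightarrow> complex set" where
  "spectrum_L M s = {\<mu>. \<not> (
     (\<forall>g. continuous_on {0..1} g \<longrightarrow>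
        (\<exists>f. continuous_on {0..1} f \<and> (\<forall>x\<in>{0..1}. Lop_c M s f x - \<mu> * f x = g x))) \<and>
     (\<forall>f. continuous_on {0..1} f \<and> (\<forall>x\<in>{0..1}. Lop_c M s f x = \<mu> * f x)
        \<longrightarrow> (\<forall>x\<in>{0..1}. f x = 0)))}"

text \<open>Spectral radius r(L_s) (of the complexification, as usual for real Banach spaces).\<close>
definition spectral_radius_L :: "nat set \<Rightarrow> real \<Rightarrow> real" where
  "spectral_radius_L M s = Sup (cmod ` spectrum_L M s)"

fun conv :: "nat list \<Rightarrow> real" where
  "conv [] = 0"
| "conv (a # as) = theta a (conv as)"

definition cf_cantor :: "nat set \<Rightarrow> real set" where
  "cf_cantor M = {x. \<exists>a::nat \<Rightarrow> nat. (\<forall>i. a i \<in> M) \<and>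
                      (\<lambda>n. conv (map a [0..<n])) \<longlonglongrightarrow> x}"

definition hausdorff_pre :: "real \<Rightarrow> real \<Rightarrow> real set \<Rightarrow> ennreal" where
  "hausdorff_pre s \<delta> E = (INF U \<in> {U :: nat \<Rightarrow> real set.
        E \<subseteq> (\<Union>i. U i) \<and> (\<forall>i. bounded (U i) \<and> diameter (U i) \<le> \<delta>)}.
        (\<Sum>i. ennreal (diameter (U i) powr s)))"

definition hausdorff_measure :: "real \<Rightarrow> real set \<Rightarrow> ennreal" where
  "hausdorff_measure s E = (SUP \<delta> \<in> {0<..}. hausdorff_pre s \<delta> E)"

definition hausdorff_dim :: "real set \<Rightarrow> real" where
  "hausdorff_dim E = Inf {s. s > 0 \<and> hausdorff_measure s E = 0}"

end

(* The eigenvector: by the distortion den w x <= 2 den w y, the sums Lone s n = L^n 1 are quasi-multiplicative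
   and hence comparable to rho^n. The Cesaro means of rho^-n L^n 1 are positive combinations of
   (p x + q)^(-2s) with q / p bounded between Min M and Max M + 1; all derivative bounds hold termwise,
   and Montel's theorem yields a limit v with L v = rho v. Domination by v makes the Neumann series of
   the resolvent converge outside the disc of radius rho, so rho is the spectral radius. Comparing
   v_s (x + 1)^(-2(t-s)) with v_t gives monotonicity and continuity. For the dimension, the cylinders of
   generation n cover the Cantor set with sum of diameters^t of order lam t ^ n. Conversely, cylinders
   of one generation lying in a set of diameter d share a prefix with cylinder of size at most O(d), because distinct
   digits separate points of the Cantor set; so if lam t >= 1 no cover has small t-sum. The bar
   theorem on the finitely branching tree of words reduces to covers by cylinders of one generation,
   which avoids constructing a measure. *)

theory Submission
  imports Defs "HOL-Complex_Analysis.Great_Picard"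
begin

section \<open>Words and the iterates of the operator\<close>

text \<open>Every \<open>Theta w\<close> is a Moebius map of determinant 1 or -1 with denominator
  \<open>den w\<close>, so distances between images have an exact formula in \<open>den w\<close>.
  Distortion, contraction and separation thus reduce to inequalities for affine functions with
  nonnegative coefficients. Means are taken because nothing is known at that stage about convergence
  of the normalised powers; for means the defect of the eigenvalue equation telescopes, and no
  spectral gap is needed. Passing to complex arguments lets a single subsequence serve all
  derivatives at once. The obstacle in the sign claim is that strict inequalities weaken in the
  limit. Therefore the derivatives of each summand are bounded below by a fixed positive multiple of
  the summand itself, which needs \<open>q / p\<close> bounded from above and excludes the empty
  word. The dimension claim asks for two digits. For one digit \<open>m\<close> with fixed point
  \<open>z\<close> of \<open>theta m\<close>, evaluation at \<open>z\<close> gives the eigenvalue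
  \<open>z powr (2 * s) < 1\<close> for every \<open>s > 0\<close>, so the value \<open>1\<close> is
  not attained.\<close>

definition Theta :: "nat list \<Rightarrow> real \<Rightarrow> real" where
  "Theta w x = foldr theta w x"

text \<open>The denominator of \<open>Theta w\<close>, built by the chain rule: the absolute
  derivative of \<open>Theta w\<close> at \<open>x\<close> is \<open>1 / den w x ^ 2\<close>. The
  values at \<open>0\<close> are the classical continuants.\<close>

fun den :: "nat list \<Rightarrow> real \<Rightarrow> real" where
  "den [] x = 1"
| "den (a # w) x = (Theta w x + real a) * den w x"

lemma Theta_simps [simp]:
  "Theta [] x = x" "Theta (a # w) x = theta a (Theta w x)"
  "Theta (u @ w) x = Theta u (Theta w x)"
  by (simp_all add: Theta_def)

lemma conv_eq_Theta: "conv w = Theta w 0"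
  by (induction w) auto

lemma den_append: "den (u @ w) x = den u (Theta w x) * den w x"
  by (induction u) auto

lemma theta_unit: "theta a x \<in> {0..1}" if "a \<noteq> 0" "x \<in> {0..1}"
proof -
  have "real a \<ge> 1" using that by linarith
  thus ?thesis using that by (auto simp: theta_def field_simps)
qed

lemma Theta_unit: "Theta w x \<in> {0..1}" if "0 \<notin> set w" "x \<in> {0..1}"
  using that(1) by (induction w) (use that(2) in \<open>auto intro!: theta_unit simp del: atLeastAtMost_iff\<close>)

lemma den_pos: "den w x > 0" if "0 \<notin> set w" "x \<in> {0..1}"
  using that(1)
proof (induction w)
  case (Cons a w)
  hence "Theta w x \<ge> 0" using Theta_unit[of w x] that(2) by simp
  moreover have "real a > 0" using Cons by simp
  ultimately show ?case using Cons by simp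
qed auto

text \<open>Each branch has determinant -1, so the difference quotient of \<open>Theta w\<close> is
  exactly plus or minus the product of the two reciprocal denominators. This identity stands in for
  the mean value theorem.\<close>

lemma Theta_diff:
  assumes "0 \<notin> set w" "x \<in> {0..1}" "y \<in> {0..1}"
  shows "\<bar>Theta w x - Theta w y\<bar> = \<bar>x - y\<bar> / (den w x * den w y)"
  using assms(1)
proof (induction w)
  case (Cons a w)
  have pos: "Theta w x + real a > 0" "Theta w y + real a > 0"
    using Theta_unit[of w x] Theta_unit[of w y] Cons(2) assms(2,3)
    by (auto simp: add_nonneg_pos)
  have "theta a (Theta w x) - theta a (Theta w y) =
     (Theta w y - Theta w x) / ((Theta w x + real a) * (Theta w y + real a))"
    using pos by (simp add: theta_def field_simps)
  hence "\<bar>theta a (Theta w x) - theta a (Theta w y)\<bar> =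
     \<bar>Theta w x - Theta w y\<bar> / ((Theta w x + real a) * (Theta w y + real a))"
    using pos by (simp add: abs_mult abs_divide abs_minus_commute)
  thus ?case using Cons by (simp add: field_simps)
qed auto

locale digits =
  fixes M :: "nat set"
  assumes finite_M: "finite M" and M_nonempty: "M \<noteq> {}" and zero_notin_M: "0 \<notin> M"
begin

definition words :: "nat \<Rightarrow> nat list set" where
  "words n = {w. set w \<subseteq> M \<and> length w = n}"

lemma finite_words: "finite (words n)"
  unfolding words_def using finite_M by (rule finite_lists_length_eq)

lemma words_zero_notin: "w \<in> words n \<Longrightarrow> 0 \<notin> set w"
  using zero_notin_M by (auto simp: words_def)

lemma words_0: "words 0 = {[]}"
  by (auto simp: words_def)

lemma words_nonempty: "words n \<noteq> {}"
proof -
  obtain m where "m \<in> M" using M_nonempty by auto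
  hence "replicate n m \<in> words n" by (auto simp: words_def)
  thus ?thesis by auto
qed

lemma sum_words_Suc: "(\<Sum>w\<in>words (Suc n). f w) = (\<Sum>w\<in>words n. \<Sum>m\<in>M. f (m # w))"
proof -
  have "(\<Sum>w\<in>words (Suc n). f w) = (\<Sum>w\<in>(\<lambda>(w, m). m # w) ` (words n \<times> M). f w)"
    unfolding words_def lists_length_Suc_eq ..
  also have "\<dots> = (\<Sum>(w, m)\<in>words n \<times> M. f (m # w))"
    by (subst sum.reindex) (auto intro!: inj_onI sum.cong)
  finally show ?thesis by (simp add: sum.cartesian_product)
qed

lemma M_bounds:
  assumes m: "m \<in> M"
  shows "1 \<le> real m \<and> real (Min M) \<le> real m \<and> real m \<le> real (Max M)"
proof -
  have "m \<noteq> 0" using m zero_notin_M by metis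
  thus ?thesis using Min_le[OF finite_M m] Max_ge[OF finite_M m] by auto
qed

lemma Min_ge_1: "real (Min M) \<ge> 1" and Max_ge_1: "real (Max M) \<ge> 1"
proof -
  have "Min M \<in> M" using finite_M M_nonempty by auto
  thus "real (Min M) \<ge> 1" "real (Max M) \<ge> 1" using M_bounds[of "Min M"] by auto
qed

lemma theta_M: "m \<in> M \<Longrightarrow> x \<in> {0..1} \<Longrightarrow> theta m x \<in> {0..1}"
  using zero_notin_M by (intro theta_unit) metis+

text \<open>Appending a digit \<^term>\<open>m\<close> turns the denominator \<open>p x + q\<close> into \<open>q x + (p + q m)\<close>;
  the growth rate \<open>3/2\<close> comes from \<open>q + (p + q m) \<ge> p + 2 q \<ge> 3/2 (p + q)\<close>.\<close>

lemma den_affine_ex: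
  assumes "set w \<subseteq> M"
  shows "\<exists>p q. (\<forall>x\<in>{0..1}. den w x = p * x + q) \<and> 0 \<le> p \<and> p \<le> q \<and>
     (3/2) ^ length w \<le> p + q \<and>
     (w \<noteq> [] \<longrightarrow> real (Min M) * p \<le> q \<and> q \<le> real (Max M + 1) * p)"
  using assms
proof (induction w rule: rev_induct)
  case Nil
  show ?case by (intro exI[of _ 0] exI[of _ 1]) auto
next
  case (snoc m w)
  have "set w \<subseteq> M" using snoc.prems by simp
  from snoc.IH[OF this] obtain p q where "\<forall>x\<in>{0..1}. den w x = p * x + q"
    and pq': "0 \<le> p" "p \<le> q" "(3/2) ^ length w \<le> p + q" by blast
  hence pq: "\<And>x. x \<in> {0..1} \<Longrightarrow> den w x = p * x + q" "0 \<le> p" "p \<le> q"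
    "(3/2) ^ length w \<le> p + q" by blast+
  have m: "m \<in> M" using snoc by auto
  note mb = M_bounds[OF m]
  have qm: "q \<le> q * real m" "real (Min M) * q \<le> q * real m" "q * real m \<le> real (Max M) * q"
    using mb pq mult_left_mono[of 1 "real m" q] mult_left_mono[of "real (Min M)" "real m" q]
      mult_left_mono[of "real m" "real (Max M)" q] by (auto simp: mult.commute)
  \<comment> \<open>The new ratio of the coefficients is \<open>real m + p / q\<close> with
    \<open>0 \<le> p / q \<le> 1\<close>; this is the origin of \<open>Min M\<close> and
    \<open>Max M + 1\<close>.\<close>
  show ?case
  proof (rule exI[of _ q], rule exI[of _ "p + q * real m"], intro conjI ballI impI)
    fix x :: real assume x: "x \<in> {0..1}"
    have "theta m x \<in> {0..1}" by (rule theta_M[OF m x])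
    hence "den (w @ [m]) x = (p * theta m x + q) * (x + real m)"
      by (simp add: den_append pq(1) del: atLeastAtMost_iff)
    also have "\<dots> = q * x + (p + q * real m)"
      using x mb by (simp add: theta_def field_simps)
    finally show "den (w @ [m]) x = q * x + (p + q * real m)" .
  next
    show "(3/2) ^ length (w @ [m]) \<le> q + (p + q * real m)"
      using pq qm by simp
  qed (use pq qm in \<open>auto simp: algebra_simps\<close>)
qed

text \<open>The leading coefficient of the affine function \<open>den w\<close>, read off at the end
  points so that no witnesses have to be chosen.\<close>

definition slope :: "nat list \<Rightarrow> real" where
  "slope w = den w 1 - den w 0"

lemma den_affine:
  assumes "set w \<subseteq> M"
  shows "x \<in> {0..1} \<Longrightarrow> den w x = slope w * x + den w 0"
    and "0 \<le> slope w" "slope w \<le> den w 0" "(3/2) ^ length w \<le> 2 * den w 0"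
    and "w \<noteq> [] \<Longrightarrow> real (Min M) * slope w \<le> den w 0"
    and "w \<noteq> [] \<Longrightarrow> den w 0 \<le> real (Max M + 1) * slope w"
proof -
  obtain p q where lin: "\<forall>x\<in>{0..1}. den w x = p * x + q" and pq: "0 \<le> p" "p \<le> q"
     "(3/2) ^ length w \<le> p + q"
     "w \<noteq> [] \<longrightarrow> real (Min M) * p \<le> q \<and> q \<le> real (Max M + 1) * p"
    using den_affine_ex[OF assms] by blast
  have *: "den w 0 = q" "den w 1 = p + q" using lin by auto
  hence "slope w = p" unfolding slope_def by simp
  note pq = lin this * pq
  with pq show "x \<in> {0..1} \<Longrightarrow> den w x = slope w * x + den w 0"
    and "0 \<le> slope w" "slope w \<le> den w 0" "(3/2) ^ length w \<le> 2 * den w 0"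
    and "w \<noteq> [] \<Longrightarrow> real (Min M) * slope w \<le> den w 0"
    and "w \<noteq> [] \<Longrightarrow> den w 0 \<le> real (Max M + 1) * slope w" by auto
qed

text \<open>On the unit interval \<open>den w\<close> rises from \<open>den w 0\<close> to
  \<open>den w 0 + slope w\<close>, at most twice its start. The constant does not depend on the
  word.\<close>

lemma den_distortion:
  assumes "set w \<subseteq> M" "x \<in> {0..1}" "y \<in> {0..1}"
  shows "den w x \<le> 2 * den w y"
proof -
  have 1: "slope w * x \<le> slope w"
    using den_affine(2)[OF assms(1)] assms(2) by (auto intro: mult_left_le)
  have 2: "0 \<le> slope w * y"
    using den_affine(2)[OF assms(1)] assms(3) by auto
  show ?thesis
    using 1 2 den_affine(1)[OF assms(1), of x] den_affine(1)[OF assms(1), of y]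
      den_affine(2,3)[OF assms(1)] assms(2,3) by linarith
qed

lemma den_lower:
  assumes "w \<in> words n" "x \<in> {0..1}"
  shows "(3/2) ^ n \<le> 2 * den w x"
proof -
  have w: "set w \<subseteq> M" "length w = n" using assms(1) by (auto simp: words_def)
  have "0 \<le> slope w * x" using den_affine(2)[OF w(1)] assms(2) by auto
  thus ?thesis using den_affine(4)[OF w(1)] den_affine(1)[OF w(1) assms(2)] w(2) by auto
qed

text \<open>Peeling off the application of the operator next to \<open>f\<close> prepends a letter
  to the word, which is the direction in which \<open>den\<close> recurses.\<close>

lemma Lop_power_words:
  assumes "x \<in> {0..1}"
  shows "(Lop M s ^^ n) f x = (\<Sum>w\<in>words n. den w x powr (-2 * s) * f (Theta w x))"
proof (induction n arbitrary: f)
  case 0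
  show ?case by (simp add: words_0)
next
  case (Suc n)
  have "(Lop M s ^^ Suc n) f x = (Lop M s ^^ n) (Lop M s f) x"
    by (simp add: funpow_swap1)
  also have "\<dots> = (\<Sum>w\<in>words n. den w x powr (-2 * s) *
      (\<Sum>m\<in>M. (Theta w x + real m) powr (-2 * s) * f (theta m (Theta w x))))"
    by (simp add: Suc Lop_def)
  also have "\<dots> = (\<Sum>w\<in>words n. \<Sum>m\<in>M. den (m # w) x powr (-2 * s) * f (Theta (m # w) x))"
  proof (intro sum.cong refl)
    fix w assume w: "w \<in> words n"
    hence "Theta w x \<ge> 0" "den w x > 0"
      using Theta_unit[of w x] den_pos[of w x] words_zero_notin[OF w] assms by auto
    thus "den w x powr (-2 * s) *
      (\<Sum>m\<in>M. (Theta w x + real m) powr (-2 * s) * f (theta m (Theta w x))) =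
      (\<Sum>m\<in>M. den (m # w) x powr (-2 * s) * f (Theta (m # w) x))"
      by (simp add: sum_distrib_left powr_mult mult_ac)
  qed
  also have "\<dots> = (\<Sum>w\<in>words (Suc n). den w x powr (-2 * s) * f (Theta w x))"
    by (simp add: sum_words_Suc)
  finally show ?case .
qed

lemma Lop_power_mono:
  assumes "x \<in> {0..1}" "\<And>y. y \<in> {0..1} \<Longrightarrow> f y \<le> h y"
  shows "(Lop M s ^^ n) f x \<le> (Lop M s ^^ n) h x"
  unfolding Lop_power_words[OF assms(1)]
  using assms(2)[OF Theta_unit[OF words_zero_notin assms(1)]] by (intro sum_mono mult_left_mono) auto

lemma Lop_mono:
  assumes "x \<in> {0..1}" "\<And>y. y \<in> {0..1} \<Longrightarrow> f y \<le> h y"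
  shows "Lop M s f x \<le> Lop M s h x"
  using Lop_power_mono[OF assms, where n = 1] by simp

lemma Lop_cong:
  assumes "x \<in> {0..1}" "\<And>y. y \<in> {0..1} \<Longrightarrow> f y = h y"
  shows "Lop M s f x = Lop M s h x"
  using assms by (intro antisym Lop_mono) auto

lemma Lop_power_scale:
  assumes "x \<in> {0..1}"
  shows "(Lop M s ^^ n) (\<lambda>y. c * f y) x = c * (Lop M s ^^ n) f x"
  unfolding Lop_power_words[OF assms] by (simp add: sum_distrib_left mult_ac)

lemma Lop_scale: "Lop M s (\<lambda>y. c * f y) x = c * Lop M s f x"
  unfolding Lop_def by (simp add: sum_distrib_left mult_ac)

lemma Lop_power_pos:
  assumes "x \<in> {0..1}" "\<And>y. y \<in> {0..1} \<Longrightarrow> f y > 0"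
  shows "(Lop M s ^^ n) f x > 0"
  unfolding Lop_power_words[OF assms(1)]
proof (rule sum_pos[OF finite_words words_nonempty])
  fix w assume "w \<in> words n"
  note w = words_zero_notin[OF this]
  show "den w x powr (-2 * s) * f (Theta w x) > 0"
    using den_pos[OF w assms(1)] assms(2)[OF Theta_unit[OF w assms(1)]] by simp
qed

lemma Lop_power_eigen:
  assumes "\<And>y. y \<in> {0..1} \<Longrightarrow> Lop M s v y = \<rho> * v y" "x \<in> {0..1}"
  shows "(Lop M s ^^ n) v x = \<rho> ^ n * v x"
  using assms(2)
proof (induction n arbitrary: x)
  case (Suc n)
  have "(Lop M s ^^ Suc n) v x = Lop M s ((Lop M s ^^ n) v) x" by simp
  also have "\<dots> = Lop M s (\<lambda>y. \<rho> ^ n * v y) x" by (rule Lop_cong) (use Suc in auto)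
  finally show ?case using assms(1)[OF Suc(2)] by (simp add: Lop_scale)
qed auto

end

section \<open>Growth of the iterates and complex extension\<close>

text \<open>A two-sided Fekete lemma. Comparing \<open>u (m * n)\<close> with both
  \<open>m * u n\<close> and \<open>n * u m\<close> shows that the intervals from
  \<open>(u n - d) / n\<close> to \<open>(u n + d) / n\<close> pairwise meet, so the supremum of
  their left ends lies in all of them.\<close>

lemma quasi_additive_linear:
  fixes u :: "nat \<Rightarrow> real"
  assumes "\<And>j k. \<bar>u (j + k) - u j - u k\<bar> \<le> d"
  shows "\<exists>l. \<forall>n. \<bar>u n - real n * l\<bar> \<le> d"
proof -
  have d: "d \<ge> 0" using assms[of 0 0] by linarith
  have mult: "\<bar>u (Suc m * n) - real (Suc m) * u n\<bar> \<le> real m * d" for m n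
  proof (induction m)
    case (Suc m)
    have "Suc (Suc m) * n = n + Suc m * n" by simp
    thus ?case using Suc assms[of n "Suc m * n"] by (simp add: algebra_simps)
  qed simp
  have mult': "\<bar>u (m * n) - real m * u n\<bar> \<le> real m * d" if m: "m > 0" for m n
  proof -
    obtain m' where m': "m = Suc m'" using m by (cases m) auto
    have "real m' * d \<le> real m * d" using d m' by (intro mult_right_mono) auto
    thus ?thesis using mult[of m' n] unfolding m' by linarith
  qed
  have cross: "(u m - d) / real m \<le> (u n + d) / real n" if "m > 0" "n > 0" for m n
  proof -
    have "real n * (u m - d) \<le> real m * (u n + d)"
      using mult'[OF that(1), of n] mult'[OF that(2), of m] by (simp add: mult.commute algebra_simps)
    thus ?thesis using that by (simp add: field_simps)
  qed
  define l where "l = (SUP m\<in>{0<..}. (u m - d) / real m)"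
  have lower: "(u n - d) / real n \<le> l" if "n > 0" for n
    unfolding l_def using that cross[of _ 1] by (intro cSUP_upper bdd_aboveI2) auto
  have upper: "l \<le> (u n + d) / real n" if "n > 0" for n
    unfolding l_def using that cross by (intro cSUP_least) auto
  show ?thesis
  proof (intro exI allI)
    fix n
    show "\<bar>u n - real n * l\<bar> \<le> d"
    proof (cases "n = 0")
      case True
      thus ?thesis using assms[of 0 0] by simp
    next
      case False
      thus ?thesis using lower[of n] upper[of n] by (simp add: field_simps abs_le_iff)
    qed
  qed
qed

text \<open>Identifies derivatives that are known by explicit formulas with the iterated
  \<open>deriv\<close>, to which the convergence theorem for holomorphic functions applies.\<close>

lemma higher_deriv_eq_sequence:
  fixes G :: "nat \<Rightarrow> complex \<Rightarrow> complex"
  assumes "open S" "\<And>k z. z \<in> S \<Longrightarrow> (G k has_field_derivative G (Suc k) z) (at z)" "z \<in> S"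
  shows "(deriv ^^ k) (G 0) z = G k z"
  using assms(3)
proof (induction k arbitrary: z)
  case (Suc k)
  have "eventually (\<lambda>y. y \<in> S) (nhds z)" using assms(1) Suc.prems by (rule eventually_nhds_in_open)
  hence "eventually (\<lambda>y. (deriv ^^ k) (G 0) y = G k y) (nhds z)"
    by eventually_elim (rule Suc.IH)
  hence "deriv ((deriv ^^ k) (G 0)) z = deriv (G k) z" by (rule deriv_cong_ev) simp
  also have "\<dots> = G (Suc k) z" using assms(2)[OF Suc.prems] by (rule DERIV_imp_deriv)
  finally show ?case by simp
qed simp

lemma higher_deriv_Re_has_derivative:
  assumes "g holomorphic_on S" "open S" "of_real x \<in> S"
  shows "((\<lambda>x. Re ((deriv ^^ k) g (of_real x))) has_real_derivative
           Re ((deriv ^^ Suc k) g (of_real x))) (at x within A)"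
proof -
  have "(deriv ^^ k) g holomorphic_on S" using assms by (intro holomorphic_higher_deriv)
  hence "((deriv ^^ k) g has_field_derivative (deriv ^^ Suc k) g (of_real x)) (at (of_real x))"
    using holomorphic_derivI[OF _ assms(2,3)] by simp
  hence "((\<lambda>x. (deriv ^^ k) g (of_real x)) has_vector_derivative (deriv ^^ Suc k) g (of_real x)) (at x within A)"
    by (rule has_vector_derivative_real_field)
  from bounded_linear.has_vector_derivative[OF bounded_linear_Re this]
  show ?thesis by (simp add: has_real_derivative_iff_has_vector_derivative)
qed

context digits
begin

definition Lone :: "real \<Rightarrow> nat \<Rightarrow> real \<Rightarrow> real" where
  "Lone s n = (Lop M s ^^ n) (\<lambda>_. 1)"

lemma Lone_words: "x \<in> {0..1} \<Longrightarrow> Lone s n x = (\<Sum>w\<in>words n. den w x powr (-2 * s))"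
  unfolding Lone_def by (simp add: Lop_power_words del: atLeastAtMost_iff)

lemma Lone_pos: "x \<in> {0..1} \<Longrightarrow> Lone s n x > 0"
  unfolding Lone_def by (rule Lop_power_pos) auto

lemma den_powr_distortion:
  assumes "w \<in> words n" "x \<in> {0..1}" "y \<in> {0..1}" "s \<ge> 0"
  shows "den w x powr (-2 * s) \<le> 2 powr (2 * s) * den w y powr (-2 * s)"
proof -
  have w: "set w \<subseteq> M" using assms(1) by (auto simp: words_def)
  have pos: "den w x > 0" "den w y > 0" using den_pos words_zero_notin assms by auto
  have "(2 * den w x) powr (-2 * s) \<le> den w y powr (-2 * s)"
    using den_distortion[OF w assms(3,2)] pos assms(4) by (intro powr_mono2') auto
  hence "2 powr (2 * s) * (2 powr (-2 * s) * den w x powr (-2 * s)) \<le> 2 powr (2 * s) * den w y powr (-2 * s)"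
    using pos by (simp add: powr_mult)
  moreover have "2 powr (2 * s) * (2 powr (-2 * s)) = (1::real)"
    by (simp flip: powr_add)
  ultimately show ?thesis by (metis mult.assoc mult_1)
qed

lemma Lone_distortion:
  assumes "x \<in> {0..1}" "y \<in> {0..1}" "s \<ge> 0"
  shows "Lone s n x \<le> 2 powr (2 * s) * Lone s n y"
  using assms unfolding Lone_words[OF assms(1)] Lone_words[OF assms(2)] sum_distrib_left
  by (intro sum_mono den_powr_distortion)

lemma Lone_add: "Lone s (j + k) = (Lop M s ^^ j) (Lone s k)"
  unfolding Lone_def by (simp add: funpow_add)

text \<open>By distortion \<open>Lone s k\<close> is constant up to the factor
  \<open>2 powr (2 * s)\<close>; replacing it by its value at \<open>0\<close> inside the remaining
  \<open>j\<close> applications of the operator gives the product.\<close>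

lemma Lone_quasi_multiplicative:
  assumes "s \<ge> 0"
  shows "Lone s (j + k) 0 \<le> 2 powr (2 * s) * (Lone s j 0 * Lone s k 0)"
    and "Lone s j 0 * Lone s k 0 \<le> 2 powr (2 * s) * Lone s (j + k) 0"
proof -
  have sc: "(Lop M s ^^ j) (\<lambda>_. c) 0 = c * Lone s j 0" for c
    using Lop_power_scale[where x = 0 and f = "\<lambda>_. 1" and c = c and n = j and s = s] by (simp add: Lone_def)
  have "Lone s (j + k) 0 \<le> (Lop M s ^^ j) (\<lambda>_. 2 powr (2 * s) * Lone s k 0) 0"
    unfolding Lone_add using assms by (intro Lop_power_mono Lone_distortion) auto
  thus "Lone s (j + k) 0 \<le> 2 powr (2 * s) * (Lone s j 0 * Lone s k 0)"
    by (simp only: sc mult_ac)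
  have "(Lop M s ^^ j) (\<lambda>_. Lone s k 0) 0 \<le> (Lop M s ^^ j) (\<lambda>x. 2 powr (2 * s) * Lone s k x) 0"
    using assms by (intro Lop_power_mono Lone_distortion) auto
  thus "Lone s j 0 * Lone s k 0 \<le> 2 powr (2 * s) * Lone s (j + k) 0"
    using Lop_power_scale[where x = 0 and f = "Lone s k" and c = "2 powr (2 * s)" and n = j and s = s] by (simp only: sc Lone_add) (simp add: mult_ac)
qed

lemma Lone_growth:
  assumes "s \<ge> 0"
  obtains \<rho> C where "\<rho> > 0" "C > 0" "\<And>n x. x \<in> {0..1} \<Longrightarrow> Lone s n x \<le> C * \<rho> ^ n"
    "\<And>n x. x \<in> {0..1} \<Longrightarrow> \<rho> ^ n \<le> C * Lone s n x"
proof -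
  define K :: real where "K = 2 powr (2 * s)"
  have K: "K > 0" by (simp add: K_def)
  note qm = Lone_quasi_multiplicative[OF assms, folded K_def]
  have P: "Lone s n 0 > 0" for n by (rule Lone_pos) auto
  have "\<bar>ln (Lone s (j + k) 0) - ln (Lone s j 0) - ln (Lone s k 0)\<bar> \<le> ln K" for j k
  proof -
    have "ln (Lone s (j + k) 0) \<le> ln (K * (Lone s j 0 * Lone s k 0))"
      using qm(1)[of j k] P by (subst ln_le_cancel_iff) (auto simp: K)
    moreover have "ln (Lone s j 0 * Lone s k 0) \<le> ln (K * Lone s (j + k) 0)"
      using qm(2)[of j k] P by (subst ln_le_cancel_iff) (auto simp: K)
    ultimately show ?thesis using K P[of j] P[of k] P[of "j + k"] by (simp add: ln_mult_pos)
  qed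
  then obtain l where l: "\<bar>ln (Lone s n 0) - real n * l\<bar> \<le> ln K" for n
    using quasi_additive_linear[of "\<lambda>n. ln (Lone s n 0)" "ln K"] by auto
  have "ln (Lone s n 0) \<le> ln (K * exp l ^ n)" "ln (exp l ^ n) \<le> ln (K * Lone s n 0)" for n
    using l[of n] K P[of n] by (auto simp: ln_mult_pos ln_realpow)
  hence b: "Lone s n 0 \<le> K * exp l ^ n" "exp l ^ n \<le> K * Lone s n 0" for n
    using K P[of n] by (metis exp_gt_zero ln_le_cancel_iff mult_pos_pos zero_less_power)+
  show ?thesis
  \<comment> \<open>One factor \<open>K\<close> is the error in the linear growth of the logarithm,
    the other moves the base point between \<open>0\<close> and \<open>x\<close>.\<close>
  proof (rule that[of "exp l" "K * K"])
    fix n and x :: real assume x: "x \<in> {0..1}"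
    have "Lone s n x \<le> K * Lone s n 0"
      unfolding K_def by (rule Lone_distortion) (use x assms in auto)
    also have "\<dots> \<le> K * (K * exp l ^ n)" using K b by (intro mult_left_mono) auto
    finally show "Lone s n x \<le> K * K * exp l ^ n" by (simp add: mult_ac)
    have "exp l ^ n \<le> K * Lone s n 0" by (rule b)
    also have "\<dots> \<le> K * (K * Lone s n x)" using K
      unfolding K_def by (intro mult_left_mono Lone_distortion) (use x assms in auto)
    finally show "exp l ^ n \<le> K * K * Lone s n x" by (simp add: mult_ac)
  qed (use K in auto)
qed

text \<open>The \<open>k\<close>-th derivative of \<open>den w z powr (-2 s)\<close>, on complex \<open>z\<close>.\<close>

definition cden :: "real \<Rightarrow> nat \<Rightarrow> nat list \<Rightarrow> complex \<Rightarrow> complex" where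
  "cden s k w z = of_real ((-1) ^ k * pochhammer (2 * s) k * slope w ^ k) *
     (of_real (slope w) * z + of_real (den w 0)) powr of_real (-2 * s - real k)"

text \<open>Because \<open>slope w \<le> den w 0\<close>, one half-plane serves all words: the base
  of the power keeps a positive real part, away from the branch cut, and is at least half its value
  at \<open>0\<close>.\<close>

lemma Re_cden_base:
  assumes "set w \<subseteq> M" "Re z > -1/2"
  shows "den w 0 / 2 \<le> Re (of_real (slope w) * z + of_real (den w 0))" "den w 0 > 0"
proof -
  have "0 \<notin> set w" using assms zero_notin_M by auto
  thus "den w 0 > 0" by (rule den_pos) auto
  have "slope w * (-1/2) \<le> slope w * Re z"
    using assms den_affine(2)[OF assms(1)] by (intro mult_left_mono) auto
  thus "den w 0 / 2 \<le> Re (of_real (slope w) * z + of_real (den w 0))"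
    using den_affine(3)[OF assms(1)] by simp
qed

lemma cden_deriv:
  assumes "set w \<subseteq> M" "Re z > -1/2"
  shows "(cden s k w has_field_derivative cden s (Suc k) w z) (at z)"
proof -
  let ?b = "of_real (slope w) * z + of_real (den w 0)"
  have "?b \<notin> \<real>\<^sub>\<le>\<^sub>0" using Re_cden_base[OF assms] by (auto simp: complex_nonpos_Reals_iff)
  hence "((\<lambda>z. (of_real (slope w) * z + of_real (den w 0)) powr of_real (-2 * s - real k))
    has_field_derivative of_real (-2 * s - real k) * ?b powr (of_real (-2 * s - real k) - 1) * of_real (slope w)) (at z)"
    by (intro DERIV_chain2[where f = "\<lambda>z. z powr of_real (-2 * s - real k)"] has_field_derivative_powr)
       (auto intro!: derivative_eq_intros)
  hence "(cden s k w has_field_derivative of_real ((-1) ^ k * pochhammer (2 * s) k * slope w ^ k) *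
     (of_real (-2 * s - real k) * ?b powr (of_real (-2 * s - real k) - 1) * of_real (slope w))) (at z)"
    unfolding cden_def by (rule DERIV_cmult)
  moreover have e: "of_real (-2 * s - real k) - 1 = complex_of_real (-2 * s - real (Suc k))" by simp
  moreover have "of_real ((-1) ^ k * pochhammer (2 * s) k * slope w ^ k) *
     (of_real (-2 * s - real k) * P * of_real (slope w)) =
     of_real ((-1) ^ Suc k * pochhammer (2 * s) (Suc k) * slope w ^ Suc k) * P" for P :: complex
    by (simp add: pochhammer_Suc algebra_simps)
  ultimately show ?thesis unfolding cden_def by metis
qed

lemma norm_cden_le:
  assumes "set w \<subseteq> M" "Re z > -1/2" "s \<ge> 0"
  shows "norm (cden s 0 w z) \<le> 2 powr (2 * s) * den w 0 powr (-2 * s)"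
proof -
  let ?b = "of_real (slope w) * z + of_real (den w 0)"
  note b = Re_cden_base[OF assms(1,2)]
  have "den w 0 / 2 \<le> norm ?b" using b complex_Re_le_cmod[of ?b] by linarith
  moreover have "Re ?b > 0" using b by linarith
  hence "?b \<noteq> 0" by (metis less_irrefl zero_complex.sel(1))
  ultimately have "norm (cden s 0 w z) \<le> (den w 0 / 2) powr (-2 * s)"
    unfolding cden_def using norm_powr_real_powr'[of "of_real (-2 * s)" ?b] b assms(3)
    by (simp add: norm_mult) (intro powr_mono2'; simp)
  also have "\<dots> = 2 powr (2 * s) * den w 0 powr (-2 * s)"
    using b by (simp add: powr_divide powr_minus field_simps)
  finally show ?thesis .
qed

lemma cden_of_real:
  assumes "set w \<subseteq> M" "x \<in> {0..1}"
  shows "cden s k w (of_real x) =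
     of_real ((-1) ^ k * pochhammer (2 * s) k * (slope w / den w x) ^ k * den w x powr (-2 * s))"
proof -
  have pos: "den w x > 0" using den_pos[of w x] assms zero_notin_M by auto
  have "of_real (slope w) * of_real x + complex_of_real (den w 0) = of_real (den w x)"
    using den_affine(1)[OF assms] by simp
  thus ?thesis using pos powr_of_real[of "den w x" "-2 * s - real k"]
    by (simp add: cden_def powr_diff powr_realpow power_divide)
qed

text \<open>Each differentiation of a power of \<open>den w\<close> brings out the factor
  \<open>slope w / den w x\<close>. The upper bound becomes the factor \<open>1 / \<gamma>\<close>
  per derivative; the lower bound preserves the strict sign. \<open>Max M + 2\<close> is
  \<open>Max M + 1\<close> plus one more slope, as \<open>x \<le> 1\<close>.\<close>

lemma slope_ratio:
  assumes "set w \<subseteq> M" "x \<in> {0..1}" "w \<noteq> []"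
  shows "1 / real (Max M + 2) \<le> slope w / den w x" "slope w / den w x \<le> 1 / real (Min M)"
proof -
  have pos: "den w x > 0" using den_pos[of w x] assms zero_notin_M by auto
  have "slope w * x \<le> slope w" "0 \<le> slope w * x"
    using den_affine(2)[OF assms(1)] assms(2) by (auto intro: mult_left_le)
  hence "real (Min M) * slope w \<le> den w x" "den w x \<le> real (Max M + 2) * slope w"
    using den_affine(5,6)[OF assms(1,3)] den_affine(1)[OF assms(1,2)] by (auto simp: algebra_simps)
  thus "1 / real (Max M + 2) \<le> slope w / den w x" "slope w / den w x \<le> 1 / real (Min M)"
    using pos Min_ge_1 by (auto simp: field_simps)
qed

section \<open>Existence of the eigenvector\<close>

lemma cden_bounds:
  fixes k :: nat
  assumes "s > 0" "set w \<subseteq> M" "w \<noteq> []" "x \<in> {0..1}"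
  defines "y \<equiv> (-1) ^ k * Re (cden s k w (of_real x))"
  shows "pochhammer (2 * s) k * (1 / real (Max M + 2)) ^ k * den w x powr (-2 * s) \<le> y"
    and "y \<le> pochhammer (2 * s) k * (1 / real (Min M)) ^ k * den w x powr (-2 * s)"
proof -
  have y: "y = pochhammer (2 * s) k * (slope w / den w x) ^ k * den w x powr (-2 * s)"
    unfolding y_def cden_of_real[OF assms(2,4)] Re_complex_of_real
    by (simp flip: mult.assoc power_mult_distrib)
  have p: "pochhammer (2 * s) k \<ge> 0" using assms(1) by (intro pochhammer_nonneg) simp
  note r = slope_ratio[OF assms(2,4,3)]
  have "0 \<le> 1 / real (Max M + 2)" by simp
  with r have "0 \<le> slope w / den w x" by linarith
  with r p show "pochhammer (2 * s) k * (1 / real (Max M + 2)) ^ k * den w x powr (-2 * s) \<le> y"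
    and "y \<le> pochhammer (2 * s) k * (1 / real (Min M)) ^ k * den w x powr (-2 * s)"
    unfolding y by (auto intro!: mult_right_mono mult_left_mono power_mono simp del: power_divide)
qed

text \<open>Cesaro means of \<open>\<rho>\<^sup>-\<^sup>j L\<^sup>j 1\<close>: they are almost fixed by \<open>L / \<rho>\<close>, and every summand is a
  positive combination of functions \<open>(p z + q) powr (-2 s)\<close> with \<open>q / p\<close> in a fixed interval.
  They are bounded on a half-plane, so Montel's theorem gives a limit along with all derivatives.\<close>

lemma eigenvector_exists:
  assumes s: "s > 0"
  obtains \<rho> and D :: "nat \<Rightarrow> real \<Rightarrow> real" where
    "\<rho> > 0"
    "\<And>x. x \<in> {0..1} \<Longrightarrow> D 0 x > 0"
    "\<And>x. x \<in> {0..1} \<Longrightarrow> Lop M s (D 0) x = \<rho> * D 0 x"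
    "\<And>k x. x \<in> {0..1} \<Longrightarrow> (D k has_real_derivative D (Suc k) x) (at x within {0..1})"
    "\<And>k x. x \<in> {0..1} \<Longrightarrow>
       pochhammer (2 * s) k * (1 / real (Max M + 2)) ^ k * D 0 x \<le> (-1) ^ k * D k x"
    "\<And>k x. x \<in> {0..1} \<Longrightarrow>
       (-1) ^ k * D k x \<le> pochhammer (2 * s) k * (1 / real (Min M)) ^ k * D 0 x"
proof -
  obtain \<rho> C where \<rho>: "\<rho> > 0" and C: "C > 0"
    and up: "\<And>n x. x \<in> {0..1} \<Longrightarrow> Lone s n x \<le> C * \<rho> ^ n"
    and lo: "\<And>n x. x \<in> {0..1} \<Longrightarrow> \<rho> ^ n \<le> C * Lone s n x"
    using Lone_growth[of s] s by auto
  \<comment> \<open>Averaging starts with the first power of the operator: the empty word has slope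
    \<open>0\<close> and would break the lower bounds on derivatives.\<close>
  define c where "c = (\<lambda>n j. 1 / (real (Suc n) * \<rho> ^ Suc j))"
  define f where "f = (\<lambda>n x. \<Sum>j\<le>n. c n j * Lone s (Suc j) x)"
  define G where "G = (\<lambda>n k z. \<Sum>j\<le>n. of_real (c n j) * (\<Sum>w\<in>words (Suc j). cden s k w z))"
  define H where "H = {z. Re z > -1/2}"
  have H: "open H" unfolding H_def by (rule open_halfspace_Re_gt)
  have Hx: "of_real x \<in> H" if "x \<in> {0..1}" for x using that by (auto simp: H_def)
  have c: "c n j > 0" for n j using \<rho> by (simp add: c_def)
  have wM: "set w \<subseteq> M" if "w \<in> words n" for w n using that by (auto simp: words_def)
  have ne: "w \<noteq> []" if "w \<in> words (Suc n)" for w n using that by (auto simp: words_def)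

  have deriv_G: "(G n k has_field_derivative G n (Suc k) z) (at z)" if "z \<in> H" for n k z
    using that unfolding G_def H_def by (intro DERIV_sum DERIV_cmult cden_deriv) (auto simp: words_def)
  have hol: "G n 0 holomorphic_on H" for n
    by (meson deriv_G field_differentiable_def has_field_derivative_at_within holomorphic_onI)

  \<comment> \<open>The lower bound keeps the limit away from zero, the upper bound makes the family
    normal.\<close>
  have f_bounds: "1 / C \<le> f n x" "f n x \<le> C" if "x \<in> {0..1}" for n x
  proof -
    have t: "c n j * Lone s (Suc j) x \<le> C / real (Suc n)" "1 / C / real (Suc n) \<le> c n j * Lone s (Suc j) x" for j
      using up[OF that, of "Suc j"] lo[OF that, of "Suc j"] \<rho> C
      by (auto simp: c_def field_simps simp del: power_Suc of_nat_Suc)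
    have "f n x \<le> (\<Sum>j\<le>n. C / real (Suc n))" "(\<Sum>j\<le>n. 1 / C / real (Suc n)) \<le> f n x"
      unfolding f_def by (intro sum_mono t)+
    thus "1 / C \<le> f n x" "f n x \<le> C" by (simp_all del: of_nat_Suc)
  qed

  have G_real: "pochhammer (2 * s) k * (1 / real (Max M + 2)) ^ k * f n x \<le> (-1) ^ k * Re (G n k (of_real x))"
    "(-1) ^ k * Re (G n k (of_real x)) \<le> pochhammer (2 * s) k * (1 / real (Min M)) ^ k * f n x"
    if x: "x \<in> {0..1}" for n k x
  proof -
    have f: "a * f n x = (\<Sum>j\<le>n. c n j * (\<Sum>w\<in>words (Suc j). a * den w x powr (-2 * s)))" for a
      by (simp add: f_def Lone_words[OF x] sum_distrib_left mult_ac)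
    have G: "(-1) ^ k * Re (G n k (of_real x)) =
       (\<Sum>j\<le>n. c n j * (\<Sum>w\<in>words (Suc j). (-1) ^ k * Re (cden s k w (of_real x))))"
      by (simp add: G_def sum_distrib_left mult_ac)
    show "pochhammer (2 * s) k * (1 / real (Max M + 2)) ^ k * f n x \<le> (-1) ^ k * Re (G n k (of_real x))"
      unfolding f G
      by (intro sum_mono mult_left_mono less_imp_le[OF c]) (rule cden_bounds(1)[OF s wM ne x], assumption+)
    show "(-1) ^ k * Re (G n k (of_real x)) \<le> pochhammer (2 * s) k * (1 / real (Min M)) ^ k * f n x"
      unfolding f G
      by (intro sum_mono mult_left_mono less_imp_le[OF c]) (rule cden_bounds(2)[OF s wM ne x], assumption+)
  qed
  \<comment> \<open>For \<open>k = 0\<close> both bounds in \<open>G_real\<close> equal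
    \<open>f n x\<close>.\<close>
  have G0: "Re (G n 0 (of_real x)) = f n x" if "x \<in> {0..1}" for n x
    using G_real[OF that, of 0 n] by simp

  have G_bound: "norm (G n 0 z) \<le> 2 powr (2 * s) * C" if z: "z \<in> H" for n z
  proof -
    have "norm (G n 0 z) \<le> (\<Sum>j\<le>n. \<Sum>w\<in>words (Suc j). c n j * norm (cden s 0 w z))"
      unfolding G_def sum_distrib_left
      by (intro order_trans[OF norm_sum] sum_mono) (use c in \<open>auto simp: norm_mult less_imp_le\<close>)
    also have "\<dots> \<le> (\<Sum>j\<le>n. \<Sum>w\<in>words (Suc j). c n j * (2 powr (2 * s) * den w 0 powr (-2 * s)))"
      using z s c wM by (intro sum_mono mult_left_mono norm_cden_le) (auto simp: H_def less_imp_le)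
    also have "\<dots> = 2 powr (2 * s) * f n 0"
      using Lone_words[of 0] by (simp add: f_def sum_distrib_left mult_ac)
    also have "\<dots> \<le> 2 powr (2 * s) * C" using f_bounds(2)[of 0 n] by (intro mult_left_mono) auto
    finally show ?thesis .
  qed

  obtain g r where g: "g holomorphic_on H" and r: "strict_mono (r :: nat \<Rightarrow> nat)"
    and unif: "\<And>K. compact K \<Longrightarrow> K \<subseteq> H \<Longrightarrow> uniform_limit K ((\<lambda>n. G n 0) \<circ> r) g sequentially"
  proof (rule Montel[OF H, of "range (\<lambda>n. G n 0)" "\<lambda>n. G n 0"])
    show "\<exists>B. \<forall>h\<in>range (\<lambda>n. G n 0). \<forall>z\<in>K. norm (h z) \<le> B" if "K \<subseteq> H" for K
      using that G_bound by (intro exI[of _ "2 powr (2 * s) * C"]) auto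
  qed (use hol in auto)

  define D where "D = (\<lambda>k x. Re ((deriv ^^ k) g (of_real x)))"
  \<comment> \<open>Weierstrass: locally uniform convergence of holomorphic functions carries over
    to every derivative.\<close>
  have D_lim: "(\<lambda>n. Re (G (r n) k (of_real x))) \<longlonglongrightarrow> D k x" if x: "x \<in> {0..1}" for k x
  proof -
    obtain e where e: "e > 0" "cball (of_real x) e \<subseteq> H"
      using H Hx[OF x] open_contains_cball by blast
    have "uniform_limit (ball (of_real x) e) (\<lambda>n. G (r n) 0) g sequentially"
      by (rule uniform_limit_on_subset[OF unif[of "cball (of_real x) e", unfolded o_def]]) (use e in auto)
    moreover have "G (r n) 0 holomorphic_on ball (of_real x) e" for n
      by (rule holomorphic_on_subset[OF hol]) (use e(2) ball_subset_cball in blast)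
    ultimately have "(\<lambda>n. (deriv ^^ k) (G (r n) 0) (of_real x)) \<longlonglongrightarrow> (deriv ^^ k) g (of_real x)"
      using e(1) by (intro higher_deriv_complex_uniform_limit[where A = "ball (of_real x) e"]) auto
    hence "(\<lambda>n. G (r n) k (of_real x)) \<longlonglongrightarrow> (deriv ^^ k) g (of_real x)"
      using higher_deriv_eq_sequence[OF H, of "G n" for n, OF deriv_G Hx[OF x]] by simp
    thus ?thesis unfolding D_def by (rule tendsto_Re)
  qed
  have f_lim: "(\<lambda>n. f (r n) x) \<longlonglongrightarrow> D 0 x" if "x \<in> {0..1}" for x
    using D_lim[OF that, of 0] G0[OF that] by simp

  have almost: "(\<lambda>n. Lop M s (f n) x - \<rho> * f n x) \<longlonglongrightarrow> 0" if x: "x \<in> {0..1}" for x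
  proof -
    \<comment> \<open>Scaled so that the \<open>j\<close>-th term of the defect is
      \<open>(a (Suc j) - a j) / real (Suc n)\<close>; the sum telescopes and the quotient tends to
      zero because \<open>a\<close> is bounded.\<close>
    define a where "a = (\<lambda>j. Lone s (Suc j) x / \<rho> ^ j)"
    have eq: "Lop M s (f n) x - \<rho> * f n x = (a (Suc n) - a 0) / real (Suc n)" for n
    proof -
      have "Lop M s (f n) x = (\<Sum>j\<le>n. \<Sum>m\<in>M. c n j * ((x + real m) powr (-2 * s) * Lone s (Suc j) (theta m x)))"
        unfolding f_def Lop_def sum_distrib_left
        by (subst sum.swap) (simp only: mult.left_commute)
      also have "\<dots> = (\<Sum>j\<le>n. c n j * Lop M s (Lone s (Suc j)) x)"
        by (simp only: Lop_def sum_distrib_left)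
      also have "\<dots> = (\<Sum>j\<le>n. c n j * Lone s (Suc (Suc j)) x)"
        by (simp add: Lone_def)
      finally have "Lop M s (f n) x = (\<Sum>j\<le>n. c n j * Lone s (Suc (Suc j)) x)" .
      hence "Lop M s (f n) x - \<rho> * f n x =
         (\<Sum>j\<le>n. c n j * Lone s (Suc (Suc j)) x - \<rho> * (c n j * Lone s (Suc j) x))"
        by (simp add: f_def sum_distrib_left sum_subtractf)
      also have "\<dots> = (\<Sum>j\<le>n. (a (Suc j) - a j) / real (Suc n))"
        using \<rho> by (intro sum.cong) (auto simp: c_def a_def field_simps simp del: of_nat_Suc)
      also have "\<dots> = (a (Suc n) - a 0) / real (Suc n)"
        using sum_telescope[of a n] sum_Suc_diff[of 0 n a]
        by (simp add: atLeast0AtMost del: of_nat_Suc flip: sum_divide_distrib)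
      finally show ?thesis .
    qed
    have a: "0 \<le> a j" "a j \<le> C * \<rho>" for j
      using up[OF x, of "Suc j"] Lone_pos[OF x, of s "Suc j"] \<rho> by (auto simp: a_def field_simps)
    have bound: "norm (Lop M s (f n) x - \<rho> * f n x) \<le> (C * \<rho>) / real (Suc n)" for n
    proof -
      have "\<bar>a (Suc n) - a 0\<bar> \<le> C * \<rho>" using a[of 0] a[of "Suc n"] by linarith
      thus ?thesis unfolding eq real_norm_def abs_divide by (simp add: divide_right_mono)
    qed
    show ?thesis
      by (rule Lim_null_comparison[OF always_eventually[OF allI[OF bound]] LIMSEQ_Suc[OF lim_const_over_n]])
  qed

  show ?thesis
  proof (rule that[of \<rho> D])
    fix x :: real assume x: "x \<in> {0..1}"
    have "1 / C \<le> D 0 x"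
      using f_lim[OF x] f_bounds(1)[OF x] by (intro LIMSEQ_le_const) auto
    thus "D 0 x > 0" using C by (meson divide_pos_pos less_le_trans zero_less_one)
    \<comment> \<open>The operator is a finite combination of point evaluations, so pointwise
      convergence is enough.\<close>
    have "(\<lambda>n. Lop M s (f (r n)) x - \<rho> * f (r n) x) \<longlonglongrightarrow> Lop M s (D 0) x - \<rho> * D 0 x"
      unfolding Lop_def using theta_M[OF _ x] x by (intro tendsto_intros f_lim)
    moreover have "(\<lambda>n. Lop M s (f (r n)) x - \<rho> * f (r n) x) \<longlonglongrightarrow> 0"
      using LIMSEQ_subseq_LIMSEQ[OF almost[OF x] r] by (simp add: o_def)
    ultimately show "Lop M s (D 0) x = \<rho> * D 0 x"
      using LIMSEQ_unique by fastforce
    fix k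
    show "(D k has_real_derivative D (Suc k) x) (at x within {0..1})"
      unfolding D_def using higher_deriv_Re_has_derivative[OF g H Hx[OF x]] .
    have lim: "(\<lambda>n. (-1) ^ k * Re (G (r n) k (of_real x))) \<longlonglongrightarrow> (-1) ^ k * D k x"
      by (intro tendsto_intros D_lim x)
    have flim: "(\<lambda>n. b * f (r n) x) \<longlonglongrightarrow> b * D 0 x" for b
      by (intro tendsto_intros f_lim x)
    show "pochhammer (2 * s) k * (1 / real (Max M + 2)) ^ k * D 0 x \<le> (-1) ^ k * D k x"
      by (rule LIMSEQ_le[OF flim lim]) (use G_real(1)[OF x] in blast)
    show "(-1) ^ k * D k x \<le> pochhammer (2 * s) k * (1 / real (Min M)) ^ k * D 0 x"
      by (rule LIMSEQ_le[OF lim flim]) (use G_real(2)[OF x] in blast)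
  qed (rule \<rho>)
qed

section \<open>Perron theory and the spectral radius\<close>

text \<open>At a maximum of \<open>u / v\<close> the multiple of \<open>v\<close> touches
  \<open>u\<close> from above. The comparison arguments apply a positive operator and evaluate at
  such a touching point; with a constant in place of \<open>v\<close> the lemma yields an ordinary
  maximum.\<close>

lemma max_ratio:
  fixes u v :: "real \<Rightarrow> real"
  assumes "continuous_on {0..1} u" "continuous_on {0..1} v" "\<And>x. x \<in> {0..1} \<Longrightarrow> v x > 0"
  obtains x0 where "x0 \<in> {0..1}" "\<And>x. x \<in> {0..1} \<Longrightarrow> u x \<le> u x0 / v x0 * v x"
proof -
  have "continuous_on {0..1} (\<lambda>x. u x / v x)"
    using assms(3) by (intro continuous_on_divide assms(1,2)) fastforce
  from continuous_attains_sup[OF _ _ this] obtain x0 where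
    x0: "x0 \<in> {0..1}" "\<And>x. x \<in> {0..1} \<Longrightarrow> u x / v x \<le> u x0 / v x0" by auto
  have "u x \<le> u x0 / v x0 * v x" if "x \<in> {0..1}" for x
    using x0(2)[OF that] assms(3)[OF that] by (simp add: divide_le_eq)
  with x0(1) show ?thesis by (rule that)
qed

text \<open>Collatz-Wielandt comparison: apply the operator to the smallest multiple of
  \<open>w\<close> above \<open>v\<close> and evaluate where the two touch.\<close>

lemma sub_super_eigenvalue:
  assumes v: "continuous_on {0..1} v" "\<And>x. x \<in> {0..1} \<Longrightarrow> v x > 0"
    "\<And>x. x \<in> {0..1} \<Longrightarrow> \<rho> * v x \<le> Lop M s v x"
    and w: "continuous_on {0..1} w" "\<And>x. x \<in> {0..1} \<Longrightarrow> w x > 0"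
    "\<And>x. x \<in> {0..1} \<Longrightarrow> Lop M s w x \<le> \<mu> * w x"
  shows "\<rho> \<le> \<mu>"
proof -
  obtain x where x: "x \<in> {0..1}" and le: "\<And>y. y \<in> {0..1} \<Longrightarrow> v y \<le> v x / w x * w y"
    using max_ratio[OF v(1) w(1,2)] by blast
  note pos = v(2)[OF x] w(2)[OF x]
  have "\<rho> * v x \<le> Lop M s v x" by (rule v(3)[OF x])
  also have "\<dots> \<le> Lop M s (\<lambda>y. v x / w x * w y) x" by (rule Lop_mono[OF x le])
  also have "\<dots> \<le> v x / w x * (\<mu> * w x)"
    unfolding Lop_scale using pos by (intro mult_left_mono w(3)[OF x]) auto
  also have "\<dots> = \<mu> * v x" using pos by simp
  finally show ?thesis using pos by simp
qed

lemma theta_fixed_point: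
  assumes "m \<in> M"
  obtains z where "z \<in> {0..1}" "theta m z = z"
proof -
  \<comment> \<open>The positive root of \<open>z * (z + m) = 1\<close>.\<close>
  define z where "z = (sqrt (real m ^ 2 + 4) - real m) / 2"
  have sq: "sqrt (real m ^ 2 + 4) ^ 2 = real m ^ 2 + 4" by simp
  have "sqrt (real m ^ 2 + 4) \<le> real m + 2"
    by (rule real_le_lsqrt) (auto simp: power2_sum)
  moreover have "real m \<le> sqrt (real m ^ 2 + 4)" by (rule real_le_rsqrt) auto
  ultimately have z: "z \<in> {0..1}" by (auto simp: z_def)
  have "z * (z + real m) = 1"
    using sq unfolding z_def power2_eq_square by (simp add: field_simps)
  moreover from this have "z + real m \<noteq> 0" by auto
  ultimately have "theta m z = z" unfolding theta_def by (simp add: divide_eq_eq)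
  with z show ?thesis by (rule that)
qed

lemma Theta_contract:
  assumes "w \<in> words n" "x \<in> {0..1}" "y \<in> {0..1}"
  shows "\<bar>Theta w x - Theta w y\<bar> \<le> 4 * (4 / 9) ^ n"
proof -
  have "(3/2) ^ n / 2 * ((3/2) ^ n / 2) \<le> den w x * den w y"
    using den_lower[OF assms(1,2)] den_lower[OF assms(1,3)] by (intro mult_mono') auto
  hence "inverse (den w x * den w y) \<le> inverse ((3/2) ^ n / 2 * ((3/2) ^ n / 2))"
    by (intro le_imp_inverse_le) auto
  also have "(3/2 :: real) ^ n / 2 * ((3/2) ^ n / 2) = (3/2 * (3/2)) ^ n / 4"
    unfolding power_mult_distrib by simp
  also have "inverse \<dots> = 4 * (4 / 9) ^ n"
    by (simp add: power_divide)
  finally have *: "1 / (den w x * den w y) \<le> 4 * (4 / 9) ^ n" by (simp only: inverse_eq_divide)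
  have pos: "0 < den w x * den w y" using den_pos words_zero_notin assms by auto
  have "\<bar>x - y\<bar> / (den w x * den w y) \<le> 1 / (den w x * den w y)"
    using assms pos by (intro divide_right_mono) auto
  thus ?thesis using * Theta_diff[OF words_zero_notin[OF assms(1)] assms(2,3)] by linarith
qed

text \<open>At a zero of \<open>u\<close> a sum of nonnegative terms vanishes, so \<open>u\<close>
  also vanishes at the image under every branch. Iterating one branch carries the zero to its fixed
  point, by contraction and continuity.\<close>

lemma nonneg_eigen_zero_orbit:
  assumes "\<And>x. x \<in> {0..1} \<Longrightarrow> u x \<ge> 0" "\<And>x. x \<in> {0..1} \<Longrightarrow> Lop M s u x = \<rho> * u x"
    "continuous_on {0..1} u" "x \<in> {0..1}" "u x = 0" "m \<in> M" "z \<in> {0..1}" "theta m z = z"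
  shows "u z = 0"
proof -
  have step: "u (theta m y) = 0" if "y \<in> {0..1}" "u y = 0" for y
  proof -
    have "Lop M s u y = 0" using assms(2) that by simp
    hence "\<forall>k\<in>M. (y + real k) powr (-2 * s) * u (theta k y) = 0"
      unfolding Lop_def using finite_M theta_M[OF _ that(1)] assms(1)
      by (subst (asm) sum_nonneg_eq_0_iff) auto
    moreover have "y + real m \<noteq> 0" using that M_bounds[OF assms(6)] by auto
    ultimately show ?thesis using assms(6) by auto
  qed
  define r where "r = (\<lambda>n. replicate n m)"
  have r: "r n \<in> words n" for n using assms(6) by (auto simp: r_def words_def)
  have in01: "Theta (r n) y \<in> {0..1}" if "y \<in> {0..1}" for n y
    using Theta_unit[OF words_zero_notin[OF r] that] .
  have zero: "u (Theta (r n) x) = 0" for n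
    by (induction n) (use step in01 assms(4,5) in \<open>auto simp: r_def simp del: atLeastAtMost_iff\<close>)
  have fixp: "Theta (r n) z = z" for n
    by (induction n) (use assms(8) in \<open>auto simp: r_def\<close>)
  have bound: "norm (Theta (r n) x - z) \<le> 4 * (4 / 9) ^ n" for n
    using Theta_contract[OF r assms(4,7)] fixp by simp
  have "(\<lambda>n. 4 * (4 / 9 :: real) ^ n) \<longlonglongrightarrow> 4 * 0"
    by (intro tendsto_mult tendsto_const LIMSEQ_power_zero) auto
  hence "(\<lambda>n. Theta (r n) x - z) \<longlonglongrightarrow> 0"
    by (intro Lim_null_comparison[OF always_eventually[OF allI[OF bound]]]) simp
  hence "(\<lambda>n. Theta (r n) x) \<longlonglongrightarrow> z" by (simp add: LIM_zero_iff)
  hence "(\<lambda>n. u (Theta (r n) x)) \<longlonglongrightarrow> u z"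
    by (rule continuous_on_tendsto_compose[OF assms(3) _ assms(7)]) (use in01[OF assms(4)] in simp)
  thus ?thesis by (simp add: zero LIMSEQ_const_iff)
qed

lemma Lop_diff: "Lop M s (\<lambda>y. f y - h y) x = Lop M s f x - Lop M s h x"
  by (simp add: Lop_def right_diff_distrib sum_subtractf)

text \<open>With \<open>a\<close> and \<open>b\<close> the largest and smallest value of
  \<open>w / v\<close>, both \<open>a * v - w\<close> and \<open>w - b * v\<close> are nonnegative
  eigenfunctions with a zero. Both zeros are transported to the same fixed point \<open>z\<close>,
  and there \<open>a = b\<close> follows.\<close>

lemma positive_eigenvector_unique:
  assumes v: "continuous_on {0..1} v" "\<And>x. x \<in> {0..1} \<Longrightarrow> v x > 0"
    "\<And>x. x \<in> {0..1} \<Longrightarrow> Lop M s v x = \<rho> * v x"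
    and w: "continuous_on {0..1} w" "\<And>x. x \<in> {0..1} \<Longrightarrow> w x > 0"
    "\<And>x. x \<in> {0..1} \<Longrightarrow> Lop M s w x = \<mu> * w x"
  shows "\<exists>c>0. \<forall>x\<in>{0..1}. w x = c * v x"
proof -
  have "\<mu> \<le> \<rho>" by (rule sub_super_eigenvalue[where v = w and w = v and s = s]) (use v w in auto)
  moreover have "\<rho> \<le> \<mu>" by (rule sub_super_eigenvalue[where v = v and w = w and s = s]) (use v w in auto)
  ultimately have \<mu>: "\<mu> = \<rho>" by simp
  obtain m where m: "m \<in> M" using M_nonempty by auto
  obtain z where z: "z \<in> {0..1}" "theta m z = z" using theta_fixed_point[OF m] .
  obtain x where x: "x \<in> {0..1}" and xle: "\<And>y. y \<in> {0..1} \<Longrightarrow> w y \<le> w x / v x * v y"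
    using max_ratio[OF w(1) v(1,2)] by blast
  obtain y where y: "y \<in> {0..1}" and yle: "\<And>x. x \<in> {0..1} \<Longrightarrow> v x \<le> v y / w y * w x"
    using max_ratio[OF v(1) w(1,2)] by blast
  have pos: "v x > 0" "w x > 0" "v y > 0" "w y > 0" using v w x y by auto
  define a b where "a = w x / v x" and "b = w y / v y"
  have a: "a > 0" "a * v x = w x" and b: "b * v y = w y" using pos by (auto simp: a_def b_def)
  have xle: "w u \<le> a * v u" if "u \<in> {0..1}" for u using xle[OF that] by (simp add: a_def)
  have yle: "b * v u \<le> w u" if "u \<in> {0..1}" for u
    using yle[OF that] pos by (simp add: b_def field_simps)
  have "a * v z - w z = 0"
    by (rule nonneg_eigen_zero_orbit[where x = x and u = "\<lambda>t. a * v t - w t" and \<rho> = \<rho> and s = s, OF _ _ _ x _ m z])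
       (use xle v w a \<mu> in \<open>auto simp: Lop_diff Lop_scale algebra_simps intro!: continuous_intros simp del: atLeastAtMost_iff\<close>)
  moreover have "w z - b * v z = 0"
    by (rule nonneg_eigen_zero_orbit[where x = y and u = "\<lambda>t. w t - b * v t" and \<rho> = \<rho> and s = s, OF _ _ _ y _ m z])
       (use yle v w b \<mu> in \<open>auto simp: Lop_diff Lop_scale algebra_simps intro!: continuous_intros simp del: atLeastAtMost_iff\<close>)
  ultimately have "a * v z = b * v z" by simp
  hence "a = b" using v(2)[OF z(1)] by simp
  hence "w u = a * v u" if "u \<in> {0..1}" for u
    using xle[OF that] yle[OF that] by simp
  thus ?thesis using a by (intro exI[of _ a]) auto
qed

section \<open>The resolvent of the complexified operator\<close>

lemma Lop_c_continuous:
  assumes "continuous_on {0..1} f"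
  shows "continuous_on {0..1} (Lop_c M s f)"
  unfolding Lop_c_def
proof (intro continuous_on_sum continuous_on_mult)
  fix m assume m: "m \<in> M"
  have pos: "x + real m \<noteq> 0" if "x \<in> {0..1}" for x using M_bounds[OF m] that by auto
  thus "continuous_on {0..1} (\<lambda>x. complex_of_real ((x + real m) powr (-2 * s)))"
    by (intro continuous_intros continuous_on_powr') auto
  have "continuous_on {0..1} (theta m)"
    unfolding theta_def using pos by (intro continuous_intros) auto
  thus "continuous_on {0..1} (\<lambda>x. f (theta m x))"
    by (rule continuous_on_compose2[OF assms]) (use theta_M[OF m] in auto)
qed

lemma norm_Lop_c_le: "norm (Lop_c M s f x) \<le> Lop M s (\<lambda>y. norm (f y)) x"
  unfolding Lop_c_def Lop_def by (rule order_trans[OF norm_sum]) (simp add: norm_mult)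

context
  fixes v :: "real \<Rightarrow> real" and \<rho> s :: real
  assumes v: "continuous_on {0..1} v" "\<And>x. x \<in> {0..1} \<Longrightarrow> v x > 0"
    "\<And>x. x \<in> {0..1} \<Longrightarrow> Lop M s v x = \<rho> * v x"
begin

lemma eigenvalue_pos: "\<rho> > 0"
proof -
  have "(Lop M s ^^ 1) v 0 > 0" by (rule Lop_power_pos) (use v in auto)
  thus ?thesis using v(2,3)[of 0] by (simp add: zero_less_mult_iff)
qed

lemma norm_Lop_c_power_le:
  assumes "\<And>x. x \<in> {0..1} \<Longrightarrow> norm (g x) \<le> B * v x" "x \<in> {0..1}"
  shows "norm ((Lop_c M s ^^ n) g x) \<le> B * \<rho> ^ n * v x"
  using assms(2)
proof (induction n arbitrary: x)
  case (Suc n)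
  have "norm ((Lop_c M s ^^ Suc n) g x) \<le> Lop M s (\<lambda>y. norm ((Lop_c M s ^^ n) g y)) x"
    by (simp add: norm_Lop_c_le)
  also have "\<dots> \<le> Lop M s (\<lambda>y. B * \<rho> ^ n * v y) x"
    by (rule Lop_mono[OF Suc.prems Suc.IH])
  also have "\<dots> = B * \<rho> ^ Suc n * v x" by (simp add: Lop_scale v(3)[OF Suc.prems])
  finally show ?case .
qed (use assms(1) in auto)

lemma resolvent_solution:
  fixes \<mu> :: complex
  assumes \<mu>: "norm \<mu> > \<rho>" and g: "continuous_on {0..1} g"
  shows "\<exists>f. continuous_on {0..1} f \<and> (\<forall>x\<in>{0..1}. Lop_c M s f x - \<mu> * f x = g x)"
proof -
  note \<rho> = eigenvalue_pos
  have \<mu>0: "\<mu> \<noteq> 0" using \<mu> \<rho> by auto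
  obtain y where y: "y \<in> {0..1}" and yle: "\<And>x. x \<in> {0..1} \<Longrightarrow> norm (g x) \<le> norm (g y) / v y * v x"
    using max_ratio[OF continuous_on_norm[OF g] v(1,2)] by blast
  define B where "B = norm (g y) / v y"
  have B: "B \<ge> 0" using v(2)[OF y] by (simp add: B_def)
  \<comment> \<open>\<open>v z\<close> is the maximum of \<open>v\<close>; it turns domination by
    \<open>v\<close> into a uniform bound.\<close>
  obtain z where z: "z \<in> {0..1}" and zle: "\<And>x. x \<in> {0..1} \<Longrightarrow> v x \<le> v z / 1 * 1"
    using max_ratio[OF v(1), of "\<lambda>_. 1"] by (auto simp: continuous_on_const)
  \<comment> \<open>The terms of the Neumann series of the inverse of \<open>\<mu> - L\<close>;
    hence the sign in the solution \<open>- S\<close>.\<close>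
  define a where "a = (\<lambda>n x. (Lop_c M s ^^ n) g x / \<mu> ^ Suc n)"
  define S where "S = (\<lambda>x. \<Sum>n. a n x)"
  define K where "K = (\<lambda>n. B * v z / norm \<mu> * (\<rho> / norm \<mu>) ^ n)"
  have K: "summable K"
    unfolding K_def using \<mu> \<rho> by (intro summable_mult summable_geometric) (auto simp: divide_less_eq)
  have aK: "norm (a n x) \<le> K n" if x: "x \<in> {0..1}" for n x
  proof -
    have "norm ((Lop_c M s ^^ n) g x) \<le> B * \<rho> ^ n * v x"
      using norm_Lop_c_power_le[OF yle x] by (simp add: B_def)
    also have "\<dots> \<le> B * \<rho> ^ n * v z" using zle[OF x] B \<rho> by (intro mult_left_mono) auto
    finally have "norm (a n x) \<le> B * \<rho> ^ n * v z / norm \<mu> ^ Suc n"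
      unfolding a_def norm_divide norm_power by (rule divide_right_mono) simp
    thus ?thesis by (simp add: K_def power_divide mult_ac)
  qed
  have cont_a: "continuous_on {0..1} (a n)" for n
  proof -
    have "continuous_on {0..1} ((Lop_c M s ^^ n) g)"
      by (induction n) (use g Lop_c_continuous in auto)
    thus ?thesis unfolding a_def using \<mu>0 by (intro continuous_intros) auto
  qed
  have "uniform_limit {0..1} (\<lambda>n x. \<Sum>i<n. a i x) S sequentially"
    unfolding S_def by (rule Weierstrass_m_test[OF aK K])
  hence cont: "continuous_on {0..1} S"
    by (rule uniform_limit_theorem[rotated]) (auto intro!: always_eventually continuous_on_sum cont_a)
  have sums: "(\<lambda>n. a n x) sums S x" if "x \<in> {0..1}" for x
    unfolding S_def using summable_comparison_test'[OF K aK[OF that]] by (rule summable_sums)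
  have eq: "Lop_c M s (\<lambda>x. - S x) x - \<mu> * (- S x) = g x" if x: "x \<in> {0..1}" for x
  proof -
    have "(\<lambda>n. Lop_c M s (a n) x) sums Lop_c M s S x"
      unfolding Lop_c_def using theta_M[OF _ x] by (intro sums_sum sums_mult sums)
    moreover have "Lop_c M s (a n) x = \<mu> * a (Suc n) x" for n
      using \<mu>0 by (simp add: a_def Lop_c_def sum_divide_distrib sum_distrib_left)
    ultimately have "(\<lambda>n. \<mu> * a (Suc n) x) sums Lop_c M s S x" by simp
    moreover have "(\<lambda>n. a (Suc n) x) sums (S x - a 0 x)"
      using sums_split_initial_segment[OF sums[OF x], of 1] by simp
    hence "(\<lambda>n. \<mu> * a (Suc n) x) sums (\<mu> * (S x - a 0 x))"
      by (rule sums_mult)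
    ultimately have "Lop_c M s S x = \<mu> * (S x - a 0 x)" by (rule sums_unique2)
    moreover have "\<mu> * a 0 x = g x" using \<mu>0 by (simp add: a_def)
    moreover have "Lop_c M s (\<lambda>x. - S x) x = - Lop_c M s S x" by (simp add: Lop_c_def sum_negf)
    ultimately show ?thesis by (simp add: algebra_simps)
  qed
  have "continuous_on {0..1} (\<lambda>x. - S x)" by (rule continuous_on_minus[OF cont])
  moreover have "\<forall>x\<in>{0..1}. Lop_c M s (\<lambda>x. - S x) x - \<mu> * (- S x) = g x" by (rule ballI[OF eq])
  ultimately have "continuous_on {0..1} (\<lambda>x. - S x) \<and>
      (\<forall>x\<in>{0..1}. Lop_c M s (\<lambda>x. - S x) x - \<mu> * (- S x) = g x)" by (rule conjI)
  thus ?thesis by (rule exI[where x = "\<lambda>x. - S x"])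
qed

text \<open>Where a multiple of \<open>v\<close> touches \<open>norm (f x)\<close> from above, the
  eigenvalue equation gives \<open>norm \<mu> * norm (f y) \<le> \<rho> * norm (f y)\<close>. So
  \<open>f\<close> vanishes there, and then so does the dominating multiple.\<close>

lemma resolvent_injective:
  fixes \<mu> :: complex
  assumes \<mu>: "norm \<mu> > \<rho>" and f: "continuous_on {0..1} f"
    "\<And>x. x \<in> {0..1} \<Longrightarrow> Lop_c M s f x = \<mu> * f x" and x: "x \<in> {0..1}"
  shows "f x = 0"
proof -
  obtain y where y: "y \<in> {0..1}" and yle: "\<And>x. x \<in> {0..1} \<Longrightarrow> norm (f x) \<le> norm (f y) / v y * v x"
    using max_ratio[OF continuous_on_norm[OF f(1)] v(1,2)] by blast
  have "norm \<mu> * norm (f y) \<le> Lop M s (\<lambda>x. norm (f x)) y"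
    using norm_Lop_c_le[of s f y] f(2)[OF y] by (simp add: norm_mult)
  also have "\<dots> \<le> Lop M s (\<lambda>x. norm (f y) / v y * v x) y" by (rule Lop_mono[OF y yle])
  also have "\<dots> = \<rho> * norm (f y)" unfolding Lop_scale using v(2,3)[OF y] by simp
  finally have "f y = 0" using \<mu> by (simp add: mult_le_cancel_right)
  thus ?thesis using yle[OF x] by simp
qed

lemma spectral_radius_eq: "spectral_radius_L M s = \<rho>"
proof -
  have "cmod \<mu> \<le> \<rho>" if "\<mu> \<in> spectrum_L M s" for \<mu>
  proof (rule ccontr)
    assume "\<not> cmod \<mu> \<le> \<rho>"
    hence "cmod \<mu> > \<rho>" by simp
    thus False using that resolvent_solution resolvent_injective unfolding spectrum_L_def by blast
  qed
  moreover have "complex_of_real \<rho> \<in> spectrum_L M s"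
  proof -
    let ?f = "\<lambda>x. complex_of_real (v x)"
    have "Lop_c M s ?f x = of_real (Lop M s v x)" for x by (simp add: Lop_c_def Lop_def)
    hence "continuous_on {0..1} ?f" "\<forall>x\<in>{0..1}. Lop_c M s ?f x = of_real \<rho> * ?f x"
      using v by (auto intro!: continuous_intros)
    moreover have "(0::real) \<in> {0..1}" "?f 0 \<noteq> 0" using v(2)[of 0] by auto
    ultimately show ?thesis unfolding spectrum_L_def by blast
  qed
  moreover have "cmod (complex_of_real \<rho>) = \<rho>" using eigenvalue_pos by simp
  ultimately show ?thesis unfolding spectral_radius_L_def
    by (intro cSup_eq_maximum) (auto intro: rev_image_eqI)
qed

end

section \<open>Dependence of the eigenvalue on the exponent\<close>

abbreviation lam :: "real \<Rightarrow> real" where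
  "lam \<equiv> spectral_radius_L M"

lemma perron:
  assumes "s > 0"
  obtains v where "continuous_on {0..1} v" "\<And>x. x \<in> {0..1} \<Longrightarrow> v x > 0"
    "\<And>x. x \<in> {0..1} \<Longrightarrow> Lop M s v x = lam s * v x" "lam s > 0"
proof -
  obtain \<rho> and D :: "nat \<Rightarrow> real \<Rightarrow> real" where D: "\<And>x. x \<in> {0..1} \<Longrightarrow> D 0 x > 0"
    "\<And>x. x \<in> {0..1} \<Longrightarrow> Lop M s (D 0) x = \<rho> * D 0 x"
    "\<And>k x. x \<in> {0..1} \<Longrightarrow> (D k has_real_derivative D (Suc k) x) (at x within {0..1})"
    using eigenvector_exists[OF assms] by metis
  have cont: "continuous_on {0..1} (D 0)" using D(3) by (rule DERIV_continuous_on)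
  have "lam s = \<rho>" using spectral_radius_eq[OF cont D(1,2)] .
  thus ?thesis using D(2) eigenvalue_pos[OF cont D(1,2)] by (intro that[OF cont D(1)]) (simp_all only:)
qed

text \<open>The bound \<open>(x + m) powr (-2 (t - s)) \<le> 1\<close> is not strict for \<open>m = 1\<close>, \<open>x = 0\<close>. Weighting \<open>v\<close> by
  \<open>(x + 1) powr (-2 (t - s))\<close> replaces it by \<open>((x + 1) / (x + m + 1)) powr (2 (t - s))\<close>.\<close>

lemma lam_upper:
  assumes "0 < s" "s \<le> t"
  shows "lam t \<le> (2 / 3) powr (2 * (t - s)) * lam s"
proof -
  obtain v where v: "continuous_on {0..1} v" "\<And>x. x \<in> {0..1} \<Longrightarrow> v x > 0"
    "\<And>x. x \<in> {0..1} \<Longrightarrow> Lop M s v x = lam s * v x" using perron[OF assms(1)] by metis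
  have "0 < t" using assms by simp
  then obtain u where u: "continuous_on {0..1} u" "\<And>x. x \<in> {0..1} \<Longrightarrow> u x > 0"
    "\<And>x. x \<in> {0..1} \<Longrightarrow> Lop M t u x = lam t * u x" using perron by metis
  define d where "d = 2 * (t - s)"
  have d: "d \<ge> 0" using assms by (simp add: d_def)
  define w where "w = (\<lambda>x::real. (x + 1) powr (-d) * v x)"
  have cont: "continuous_on {0..1} w"
    unfolding w_def by (intro continuous_intros continuous_on_powr' v) auto
  have pos: "w x > 0" if "x \<in> {0..1}" for x using v(2)[OF that] that by (auto simp: w_def)
  have le: "Lop M t w x \<le> (2 / 3) powr d * lam s * w x" if x: "x \<in> {0..1}" for x
  proof -
    have "Lop M t w x \<le> (\<Sum>m\<in>M. (2/3) powr d * (x + 1) powr (-d) * ((x + real m) powr (-2 * s) * v (theta m x)))"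
      unfolding Lop_def
    proof (rule sum_mono)
      fix m assume m: "m \<in> M"
      have m1: "real m \<ge> 1" using M_bounds[OF m] by simp
      have pos: "x + real m > 0" "x + 1 > 0" "v (theta m x) > 0" using x m1 v(2)[OF theta_M[OF m x]] by auto
      have "theta m x + 1 = (x + real m + 1) / (x + real m)" using pos by (simp add: theta_def field_simps)
      hence "(x + real m) powr (-d) * (theta m x + 1) powr (-d) = (x + real m + 1) powr (-d)"
        using pos by (simp flip: powr_mult)
      \<comment> \<open>\<open>x + real m + 1 \<ge> x + 2 \<ge> 3/2 * (x + 1)\<close>, as
        \<open>x \<le> 1\<close>.\<close>
      also have "\<dots> \<le> (3/2 * (x + 1)) powr (-d)"
        using d x m1 by (intro powr_mono2') auto
      also have "\<dots> = (2/3) powr d * (x + 1) powr (-d)"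
      proof -
        have "(3/2::real) powr (-d) = (2/3) powr d"
          using powr_divide[of 2 3 d] powr_divide[of 3 2 d] by (simp add: powr_minus inverse_eq_divide)
        moreover have "(3/2 * (x + 1)) powr (-d) = (3/2) powr (-d) * (x + 1) powr (-d)"
          using pos powr_mult[of "3/2" "x + 1" "-d"] by argo
        ultimately show ?thesis by (simp only:)
      qed
      finally have "(x + real m) powr (-d) * (theta m x + 1) powr (-d) \<le> (2/3) powr d * (x + 1) powr (-d)" .
      hence "(x + real m) powr (-d) * (theta m x + 1) powr (-d) * ((x + real m) powr (-2 * s) * v (theta m x))
         \<le> (2/3) powr d * (x + 1) powr (-d) * ((x + real m) powr (-2 * s) * v (theta m x))"
        using pos by (intro mult_right_mono) auto
      moreover have "(x + real m) powr (-2 * t) = (x + real m) powr (-d) * (x + real m) powr (-2 * s)"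
        by (simp add: d_def algebra_simps flip: powr_add)
      ultimately show "(x + real m) powr (-2 * t) * w (theta m x) \<le>
         (2/3) powr d * (x + 1) powr (-d) * ((x + real m) powr (-2 * s) * v (theta m x))"
        by (simp add: w_def mult_ac)
    qed
    also have "\<dots> = (2/3) powr d * (x + 1) powr (-d) * Lop M s v x"
      by (simp add: Lop_def sum_distrib_left)
    also have "\<dots> = (2 / 3) powr d * lam s * w x" by (simp add: v(3)[OF x] w_def)
    finally show ?thesis .
  qed
  have "lam t \<le> (2 / 3) powr d * lam s"
    by (rule sub_super_eigenvalue[where v = u and w = w and s = t]) (use u cont pos le in auto)
  thus ?thesis by (simp add: d_def)
qed

text \<open>The eigenvector for \<open>s\<close> is a subsolution for \<open>t\<close>: changing the
  exponent multiplies each summand by \<open>(x + real m) powr (-2 * (t - s))\<close>, and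
  \<open>x + real m \<le> Max M + 1\<close>.\<close>

lemma lam_lower:
  assumes "0 < s" "s \<le> t"
  shows "real (Max M + 1) powr (-2 * (t - s)) * lam s \<le> lam t"
proof -
  obtain v where v: "continuous_on {0..1} v" "\<And>x. x \<in> {0..1} \<Longrightarrow> v x > 0"
    "\<And>x. x \<in> {0..1} \<Longrightarrow> Lop M s v x = lam s * v x" using perron[OF assms(1)] by metis
  have "0 < t" using assms by simp
  then obtain u where u: "continuous_on {0..1} u" "\<And>x. x \<in> {0..1} \<Longrightarrow> u x > 0"
    "\<And>x. x \<in> {0..1} \<Longrightarrow> Lop M t u x = lam t * u x" using perron by metis
  have le: "real (Max M + 1) powr (-2 * (t - s)) * lam s * v x \<le> Lop M t v x" if x: "x \<in> {0..1}" for x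
  proof -
    have "real (Max M + 1) powr (-2 * (t - s)) * Lop M s v x \<le> Lop M t v x"
      unfolding Lop_def sum_distrib_left mult.assoc[symmetric]
    proof (intro sum_mono mult_right_mono)
      fix m assume m: "m \<in> M"
      show "0 \<le> v (theta m x)" using v(2)[OF theta_M[OF m x]] by simp
      have "real (Max M + 1) powr (-2 * (t - s)) \<le> (x + real m) powr (-2 * (t - s))"
        using assms x M_bounds[OF m] by (intro powr_mono2') auto
      hence "real (Max M + 1) powr (-2 * (t - s)) * (x + real m) powr (-2 * s) \<le>
         (x + real m) powr (-2 * (t - s)) * (x + real m) powr (-2 * s)"
        by (intro mult_right_mono) auto
      also have "\<dots> = (x + real m) powr (-2 * t)" by (simp add: algebra_simps flip: powr_add)
      finally show "real (Max M + 1) powr (-2 * (t - s)) * (x + real m) powr (-2 * s) \<le> (x + real m) powr (-2 * t)" .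
    qed
    thus ?thesis by (simp add: v(3)[OF x] mult.assoc)
  qed
  show ?thesis by (rule sub_super_eigenvalue[where v = v and w = u and s = t]) (use u v le in auto)
qed

lemma lam_pos: "s > 0 \<Longrightarrow> lam s > 0"
  using perron by metis

lemma lam_strict_antimono: "strict_antimono_on {0<..} lam"
proof (rule monotone_onI)
  fix s t :: real assume st: "s \<in> {0<..}" "t \<in> {0<..}" "s < t"
  have "(2 / 3 :: real) powr (2 * (t - s)) < (2 / 3) powr 0" using st by (intro powr_less_mono') auto
  hence "(2 / 3) powr (2 * (t - s)) * lam s < 1 * lam s"
    using lam_pos[of s] st by (intro mult_strict_right_mono) auto
  thus "lam t < lam s" using lam_upper[of s t] st by auto
qed

lemma lam_continuous: "continuous_on {0<..} lam"
proof -
  \<comment> \<open>The rate in \<open>lam_lower\<close>, which becomes a Lipschitz constant for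
    \<open>ln (lam s)\<close>.\<close>
  define K where "K = 2 * ln (real (Max M + 1))"
  have K: "K \<ge> 0" unfolding K_def using Max_ge_1 by simp
  have lip: "\<bar>ln (lam s) - ln (lam t)\<bar> \<le> K * \<bar>s - t\<bar>" if "0 < s" "s \<le> t" for s t
  proof -
    have pos: "lam s > 0" "lam t > 0" using that lam_pos by auto
    have "ln (real (Max M + 1) powr (-2 * (t - s)) * lam s) \<le> ln (lam t)"
      using lam_lower[OF that] pos by (subst ln_le_cancel_iff) auto
    hence "ln (lam s) - ln (lam t) \<le> K * \<bar>s - t\<bar>"
      using pos that by (simp add: ln_mult_pos ln_powr K_def algebra_simps)
    moreover have "lam t \<le> lam s"
      using monotone_onD[OF lam_strict_antimono, of s t] that by (cases "s = t") auto
    hence "ln (lam t) \<le> ln (lam s)" using pos by simp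
    ultimately show ?thesis by (simp add: abs_if)
  qed
  have "K-lipschitz_on {0<..} (\<lambda>s. ln (lam s))"
  proof (rule lipschitz_onI[OF _ K])
    fix s t :: real assume "s \<in> {0<..}" "t \<in> {0<..}"
    thus "dist (ln (lam s)) (ln (lam t)) \<le> K * dist s t"
      using lip[of s t] lip[of t s] by (cases "s \<le> t") (auto simp: dist_real_def abs_minus_commute)
  qed
  hence "continuous_on {0<..} (\<lambda>s. exp (ln (lam s)))"
    by (intro continuous_on_exp lipschitz_on_continuous_on)
  thus ?thesis by (rule continuous_on_eq) (use lam_pos in auto)
qed

lemma lam_eq_1_exists:
  assumes "card M \<ge> 2"
  obtains s where "s > 0" "lam s = 1"
proof -
  define N where "N = real (Max M + 1)"
  have N: "N \<ge> 2" unfolding N_def using Max_ge_1 by simp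
  \<comment> \<open>Chosen so that \<open>N powr (-2 * a) = 1 / 2\<close>: two digits already make
    the constant \<open>1\<close> a subsolution with factor \<open>1\<close>.\<close>
  define a where "a = ln 2 / (2 * ln N)"
  have a: "a > 0" unfolding a_def using N by auto
  have "1 \<le> lam a"
  proof -
    obtain v where v: "continuous_on {0..1} v" "\<And>x. x \<in> {0..1} \<Longrightarrow> v x > 0"
      "\<And>x. x \<in> {0..1} \<Longrightarrow> Lop M a v x = lam a * v x" using perron[OF a] by metis
    have le: "1 \<le> Lop M a (\<lambda>_. 1) x" if x: "x \<in> {0..1}" for x
    proof -
      have "N powr (-2 * a) = 1 / 2"
      proof -
        have "-2 * a * ln N = - ln 2" using N by (simp add: a_def field_simps)
        thus ?thesis using N by (simp add: powr_def exp_minus inverse_eq_divide)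
      qed
      hence "1 \<le> real (card M) * N powr (-2 * a)"
        using mult_right_mono[of 2 "real (card M)" "N powr (-2 * a)"] assms by simp
      also have "\<dots> = (\<Sum>m\<in>M. N powr (-2 * a))" by simp
      also have "\<dots> \<le> (\<Sum>m\<in>M. (x + real m) powr (-2 * a))"
      proof (rule sum_mono)
        fix m assume "m \<in> M"
        thus "N powr (-2 * a) \<le> (x + real m) powr (-2 * a)"
          using a x M_bounds[of m] by (intro powr_mono2') (auto simp: N_def)
      qed
      finally show ?thesis by (simp add: Lop_def)
    qed
    show ?thesis
      by (rule sub_super_eigenvalue[where v = "\<lambda>_. 1" and w = v and s = a]) (use v le in auto)
  qed
  \<comment> \<open>The exponent at which the upper estimate of \<open>lam_upper\<close>, started at
    \<open>a\<close>, has come down to \<open>1\<close>.\<close>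
  define b where "b = a + ln (lam a) / (2 * ln (3 / 2))"
  have ab: "a \<le> b" using \<open>1 \<le> lam a\<close> by (simp add: b_def)
  have "(2 / 3) powr (2 * (b - a)) * lam a = 1"
  proof -
    have "ln (2 / 3 :: real) = - ln (3 / 2)" by (simp add: ln_div)
    hence "2 * (b - a) * ln (2 / 3) = - ln (lam a)" by (simp add: b_def field_simps)
    thus ?thesis using \<open>1 \<le> lam a\<close> by (simp add: powr_def exp_minus)
  qed
  hence "lam b \<le> 1" using lam_upper[OF a ab] by simp
  moreover have "continuous_on {a..b} lam"
    by (rule continuous_on_subset[OF lam_continuous]) (use a in auto)
  ultimately obtain s where "a \<le> s" "s \<le> b" "lam s = 1"
    using IVT2'[of lam b 1 a] \<open>1 \<le> lam a\<close> ab by auto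
  thus ?thesis using a by (intro that[of s]) auto
qed

end

section \<open>Hausdorff dimension\<close>

text \<open>\<open>u\<close> is the longest common prefix. Equal lengths rule out that one word
  properly extends another, so either there is one word or two words branch right after
  \<open>u\<close>.\<close>

lemma common_prefix:
  assumes "W \<noteq> {}" "\<And>w. w \<in> W \<Longrightarrow> length w = n"
  shows "\<exists>u. (\<forall>w\<in>W. \<exists>v. w = u @ v) \<and> (W = {u} \<or> (\<exists>a b v v'. a \<noteq> b \<and> u @ a # v \<in> W \<and> u @ b # v' \<in> W))"
  using assms
proof (induction n arbitrary: W)
  case 0
  hence "W = {[]}" by auto
  thus ?case by auto
next
  case (Suc n)
  have cons: "\<exists>a v. w = a # v" if "w \<in> W" for w using Suc.prems(2)[OF that] by (cases w) auto
  obtain a v0 where av: "a # v0 \<in> W" using Suc.prems(1) cons by blast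
  show ?case
  proof (cases "\<exists>b v. b # v \<in> W \<and> b \<noteq> a")
    case True
    then obtain b v where "b # v \<in> W" "b \<noteq> a" by auto
    hence "\<exists>a b v v'. a \<noteq> b \<and> [] @ a # v \<in> W \<and> [] @ b # v' \<in> W"
      using av by (metis append_Nil)
    moreover have "\<forall>w\<in>W. \<exists>v. w = [] @ v" by simp
    ultimately show ?thesis by blast
  next
    case False
    define W' where "W' = {v. a # v \<in> W}"
    have W: "W = (#) a ` W'" using False cons unfolding W'_def by (force simp: image_iff)
    have "W' \<noteq> {}" "\<And>v. v \<in> W' \<Longrightarrow> length v = n" using av Suc.prems(2) by (fastforce simp: W'_def)+
    from Suc.IH[OF this] obtain u where u: "\<forall>w\<in>W'. \<exists>v. w = u @ v"
      "W' = {u} \<or> (\<exists>a b v v'. a \<noteq> b \<and> u @ a # v \<in> W' \<and> u @ b # v' \<in> W')" by blast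
    show ?thesis
    proof (intro exI[of _ "a # u"] conjI)
      show "\<forall>w\<in>W. \<exists>v. w = (a # u) @ v" using u(1) unfolding W by auto
      show "W = {a # u} \<or> (\<exists>c b v v'. c \<noteq> b \<and> (a # u) @ c # v \<in> W \<and> (a # u) @ b # v' \<in> W)"
        using u(2)
      proof
        assume "W' = {u}"
        thus ?thesis unfolding W by simp
      next
        assume "\<exists>a b v v'. a \<noteq> b \<and> u @ a # v \<in> W' \<and> u @ b # v' \<in> W'"
        thus ?thesis unfolding W'_def by auto
      qed
    qed
  qed
qed

lemma powr_square:
  fixes x :: real
  assumes "x > 0"
  shows "(x ^ 2) powr t = x powr (2 * t)"
proof -
  have "x ^ 2 = x powr 2" using assms by simp
  thus ?thesis by (simp only: powr_powr)
qed

text \<open>Allows a set of a cover, possibly of diameter \<open>0\<close>, to be replaced by a ball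
  of positive radius at arbitrarily small cost.\<close>

lemma powr_enlarge:
  fixes d :: real
  assumes "d \<ge> 0" "t > 0" "e > 0"
  obtains \<eta> where "\<eta> > 0" "(d + \<eta>) powr t \<le> d powr t + e"
proof -
  have "continuous_on {0..} (\<lambda>x::real. x powr t)"
    using assms(2) by (intro continuous_on_powr' continuous_intros) auto
  then obtain r where r: "r > 0" "\<And>x. x \<ge> 0 \<Longrightarrow> dist x d < r \<Longrightarrow> dist (x powr t) (d powr t) < e"
    using assms(1,3) unfolding continuous_on_iff by (metis atLeast_iff)
  have "dist ((d + r / 2) powr t) (d powr t) < e"
    using r(1) assms(1) by (intro r(2)) (auto simp: dist_real_def)
  thus ?thesis using r(1) by (intro that[of "r / 2"]) (auto simp: dist_real_def)
qed

text \<open>The finite family is padded to a sequence by empty sets; their diameter is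
  \<open>0\<close> and \<open>0 powr t = 0\<close>, so they add nothing.\<close>

lemma hausdorff_pre_le:
  assumes "finite A" "E \<subseteq> (\<Union>w\<in>A. U w)" "\<And>w. w \<in> A \<Longrightarrow> bounded (U w)"
    "\<And>w. w \<in> A \<Longrightarrow> diameter (U w) \<le> \<delta>" "\<delta> \<ge> 0"
  shows "hausdorff_pre t \<delta> E \<le> ennreal (\<Sum>w\<in>A. diameter (U w) powr t)"
proof -
  obtain h where h: "bij_betw h {0..<card A} A" using ex_bij_betw_nat_finite[OF assms(1)] by blast
  define V where "V = (\<lambda>i. if i < card A then U (h i) else {})"
  have hA: "h i \<in> A" if "i < card A" for i using h that by (auto simp: bij_betw_def)
  have "E \<subseteq> (\<Union>i. V i)"
  proof
    fix x assume "x \<in> E"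
    then obtain w where "w \<in> A" "x \<in> U w" using assms(2) by auto
    moreover from this have "w \<in> h ` {0..<card A}" using bij_betw_imp_surj_on[OF h] by simp
    ultimately obtain i where "i < card A" "x \<in> U (h i)" by auto
    thus "x \<in> (\<Union>i. V i)" by (auto simp: V_def)
  qed
  moreover have "bounded (V i)" "diameter (V i) \<le> \<delta>" for i
    using assms(3,4)[OF hA[of i]] assms(5) by (auto simp: V_def)
  ultimately have "hausdorff_pre t \<delta> E \<le> (\<Sum>i. ennreal (diameter (V i) powr t))"
    unfolding hausdorff_pre_def by (intro INF_lower) auto
  also have "\<dots> = (\<Sum>i\<in>{0..<card A}. ennreal (diameter (V i) powr t))"
    by (rule suminf_finite) (auto simp: V_def)
  also have "\<dots> = (\<Sum>i\<in>{0..<card A}. ennreal (diameter (U (h i)) powr t))"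
    by (intro sum.cong) (auto simp: V_def)
  also have "\<dots> = (\<Sum>w\<in>A. ennreal (diameter (U w) powr t))"
    using sum.reindex_bij_betw[OF h] .
  finally show ?thesis by simp
qed

section \<open>Infinite digit sequences and covers of the Cantor set by cylinders\<close>

context digits
begin

text \<open>Koenig's lemma: a word below which no uniform depth works has a one-letter extension
  with the same defect. Following such extensions gives an infinite sequence that never meets the
  bar.\<close>

lemma bar_induction:
  assumes bar: "\<And>a. (\<And>i. a i \<in> M) \<Longrightarrow> \<exists>n. P (map a [0..<n])"
    and mono: "\<And>u v. P u \<Longrightarrow> set v \<subseteq> M \<Longrightarrow> P (u @ v)"
  shows "\<exists>n. \<forall>w\<in>words n. P w"
proof -
  define G where "G = (\<lambda>w. \<exists>n. \<forall>v\<in>words n. P (w @ v))"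
  have step: "\<exists>m\<in>M. \<not> G (w @ [m])" if "\<not> G w" for w
  proof (rule ccontr)
    assume "\<not> (\<exists>m\<in>M. \<not> G (w @ [m]))"
    hence "\<forall>m\<in>M. \<exists>n. \<forall>v\<in>words n. P ((w @ [m]) @ v)" by (auto simp: G_def)
    then obtain k where k: "\<And>m v. m \<in> M \<Longrightarrow> v \<in> words (k m) \<Longrightarrow> P ((w @ [m]) @ v)" by metis
    \<comment> \<open>The depths below the finitely many extensions are replaced by their maximum;
      \<open>mono\<close> covers the surplus letters.\<close>
    have "P (w @ v)" if v: "v \<in> words (Suc (Max (k ` M)))" for v
    proof -
      obtain m v' where mv: "v = m # v'" "m \<in> M" "set v' \<subseteq> M" "length v' = Max (k ` M)"
        using v by (cases v) (auto simp: words_def)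
      have "k m \<le> length v'" using mv finite_M by simp
      hence "take (k m) v' \<in> words (k m)" using mv set_take_subset[of "k m" v'] by (auto simp: words_def)
      moreover have "set (drop (k m) v') \<subseteq> M" using mv(3) set_drop_subset[of "k m" v'] by blast
      ultimately have "P (((w @ [m]) @ take (k m) v') @ drop (k m) v')" by (intro mono k mv(2))
      thus ?thesis by (simp add: mv(1))
    qed
    hence "G w" unfolding G_def by blast
    thus False using that by simp
  qed
  have "G []"
  proof (rule ccontr)
    assume "\<not> G []"
    hence "\<exists>f. \<forall>n. (f n \<in> words n \<and> \<not> G (f n)) \<and> (\<exists>m\<in>M. f (Suc n) = f n @ [m])"
    proof (intro dependent_nat_choice)
      fix w n assume w: "w \<in> words n \<and> \<not> G w"
      then obtain m where "m \<in> M" "\<not> G (w @ [m])" using step by blast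
      thus "\<exists>y. (y \<in> words (Suc n) \<and> \<not> G y) \<and> (\<exists>m\<in>M. y = w @ [m])"
        using w by (intro exI[of _ "w @ [m]"]) (auto simp: words_def)
    qed (auto simp: words_0)
    then obtain f where f: "\<And>n. f n \<in> words n" "\<And>n. \<not> G (f n)" "\<And>n. \<exists>m\<in>M. f (Suc n) = f n @ [m]"
      by blast
    define a where "a = (\<lambda>n. last (f (Suc n)))"
    have aM: "a n \<in> M" and fS: "f (Suc n) = f n @ [a n]" for n
      using f(3)[of n] by (auto simp: a_def)
    have fn: "f n = map a [0..<n]" for n
      by (induction n) (use f(1)[of 0] fS in \<open>auto simp: words_0\<close>)
    obtain n where "P (map a [0..<n])" using bar[of a, OF aM] by blast
    \<comment> \<open>At the bar depth \<open>0\<close> suffices, since \<open>words 0\<close>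
      contains only the empty word.\<close>
    hence "G (f n)" unfolding G_def fn by (intro exI[of _ 0]) (simp add: words_0)
    thus False using f(2) by simp
  qed
  thus ?thesis by (simp add: G_def)
qed

text \<open>Convergents that share \<open>n\<close> digits lie in one cylinder, so they form a
  Cauchy sequence. The estimate is stated for all \<open>y\<close> in order to place the whole
  cylinder near \<open>x\<close>.\<close>

lemma cf_point:
  assumes a: "\<And>i. a i \<in> M"
  obtains x where "x \<in> cf_cantor M" "\<And>n y. y \<in> {0..1} \<Longrightarrow> \<bar>x - Theta (map a [0..<n]) y\<bar> \<le> 4 * (4/9) ^ n"
proof -
  have w: "map a [0..<n] \<in> words n" for n using a by (auto simp: words_def)
  have near: "\<bar>conv (map a [0..<n + k]) - Theta (map a [0..<n]) y\<bar> \<le> 4 * (4/9) ^ n"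
    if y: "y \<in> {0..1}" for n k y
  proof -
    have e: "conv (map a [0..<n + k]) = Theta (map a [0..<n]) (Theta (map a [n..<n + k]) 0)"
      by (simp add: conv_eq_Theta upt_add_eq_append[OF le0])
    have "0 \<notin> set (map a [n..<n + k])" using a zero_notin_M by (metis ex_map_conv)
    hence "Theta (map a [n..<n + k]) 0 \<in> {0..1}" by (rule Theta_unit) simp
    thus ?thesis unfolding e by (rule Theta_contract[OF w _ y])
  qed
  have small: "(\<lambda>n. 4 * (4/9 :: real) ^ n) \<longlonglongrightarrow> 4 * 0"
    by (intro tendsto_mult tendsto_const LIMSEQ_power_zero) auto
  have "Cauchy (\<lambda>n. conv (map a [0..<n]))"
  proof (rule metric_CauchyI)
    fix e :: real assume e: "0 < e"
    then obtain N where N: "4 * (4/9) ^ N < e / 2"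
      using order_tendstoD(2)[OF small, of "e / 2"] by (auto simp: eventually_sequentially)
    have near': "\<bar>conv (map a [0..<n]) - Theta (map a [0..<N]) 0\<bar> < e / 2" if "n \<ge> N" for n
      using near[of 0 N "n - N"] that N by simp
    show "\<exists>N. \<forall>m\<ge>N. \<forall>n\<ge>N. dist (conv (map a [0..<m])) (conv (map a [0..<n])) < e"
    proof (intro exI[of _ N] allI impI)
      fix m n assume "m \<ge> N" "n \<ge> N"
      thus "dist (conv (map a [0..<m])) (conv (map a [0..<n])) < e"
        using near'[of m] near'[of n] unfolding dist_real_def by linarith
    qed
  qed
  then obtain x where x: "(\<lambda>n. conv (map a [0..<n])) \<longlonglongrightarrow> x"
    using Cauchy_convergent convergent_def by blast
  show ?thesis
  proof (rule that[of x])
    show "x \<in> cf_cantor M" unfolding cf_cantor_def using a x by blast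
    fix n and y :: real assume y: "y \<in> {0..1}"
    have "(\<lambda>k. conv (map a [0..<n + k])) \<longlonglongrightarrow> x"
      using LIMSEQ_ignore_initial_segment[OF x, of n] by (simp add: add.commute)
    hence "(\<lambda>k. \<bar>conv (map a [0..<n + k]) - Theta (map a [0..<n]) y\<bar>) \<longlonglongrightarrow> \<bar>x - Theta (map a [0..<n]) y\<bar>"
      by (intro tendsto_intros)
    thus "\<bar>x - Theta (map a [0..<n]) y\<bar> \<le> 4 * (4/9) ^ n"
      by (rule LIMSEQ_le_const2) (use near[OF y] in blast)
  qed
qed

text \<open>The constant \<open>1\<close> lies between two multiples of the eigenvector, whose
  iterates are explicit. In contrast to \<open>Lone_growth\<close>, the rate is now identified as
  \<open>lam t\<close>.\<close>

lemma den_sum_bounds: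
  assumes "t > 0"
  obtains K where "K > 0" "\<And>n x. x \<in> {0..1} \<Longrightarrow> (\<Sum>w\<in>words n. den w x powr (-2 * t)) \<le> K * lam t ^ n"
    "\<And>n x. x \<in> {0..1} \<Longrightarrow> lam t ^ n \<le> K * (\<Sum>w\<in>words n. den w x powr (-2 * t))"
proof -
  obtain v where v: "continuous_on {0..1} v" "\<And>x. x \<in> {0..1} \<Longrightarrow> v x > 0"
    "\<And>x. x \<in> {0..1} \<Longrightarrow> Lop M t v x = lam t * v x" using perron[OF assms] by metis
  have one: "continuous_on {0..1} (\<lambda>_::real. 1::real)" by (rule continuous_on_const)
  obtain y where y: "y \<in> {0..1}" and yle: "\<And>x. x \<in> {0..1} \<Longrightarrow> v x \<le> v y / 1 * 1"
    using max_ratio[OF v(1) one] by auto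
  obtain z where z: "z \<in> {0..1}" and zle: "\<And>x. x \<in> {0..1} \<Longrightarrow> 1 \<le> 1 / v z * v x"
    using max_ratio[OF one v(1,2)] by blast
  have pos: "v y > 0" "v z > 0" using v(2) y z by auto
  note lp = lam_pos[OF assms]
  define K where "K = v y / v z"
  show ?thesis
  proof (rule that[of K])
    show "K > 0" using pos by (simp add: K_def)
    fix n and x :: real assume x: "x \<in> {0..1}"
    have L1: "(\<Sum>w\<in>words n. den w x powr (-2 * t)) = (Lop M t ^^ n) (\<lambda>_. 1) x"
      by (simp add: Lop_power_words[OF x])
    have eigen: "(Lop M t ^^ n) v x = lam t ^ n * v x" by (rule Lop_power_eigen[OF v(3) x])
    have "(Lop M t ^^ n) (\<lambda>_. 1) x \<le> (Lop M t ^^ n) (\<lambda>x. 1 / v z * v x) x"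
      by (rule Lop_power_mono[OF x zle])
    also have "\<dots> = 1 / v z * (lam t ^ n * v x)"
      unfolding Lop_power_scale[OF x] eigen ..
    also have "\<dots> \<le> 1 / v z * (lam t ^ n * v y)"
      using yle[OF x] pos lp by (intro mult_left_mono) auto
    finally show "(\<Sum>w\<in>words n. den w x powr (-2 * t)) \<le> K * lam t ^ n" unfolding L1 K_def by (simp add: mult_ac)
    have "lam t ^ n * v z \<le> lam t ^ n * v x"
      using zle[OF x] pos lp by (intro mult_left_mono) (auto simp: field_simps)
    also have "\<dots> = (Lop M t ^^ n) v x" by (rule eigen[symmetric])
    also have "\<dots> \<le> (Lop M t ^^ n) (\<lambda>_. v y * 1) x"
      using yle by (intro Lop_power_mono[OF x]) simp
    also have "\<dots> = v y * (\<Sum>w\<in>words n. den w x powr (-2 * t))"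
      unfolding Lop_power_scale[OF x] L1 ..
    finally show "lam t ^ n \<le> K * (\<Sum>w\<in>words n. den w x powr (-2 * t))"
      using pos by (simp add: K_def field_simps)
  qed
qed

text \<open>\<open>den w\<close> is smallest at \<open>0\<close>, so by \<open>Theta_diff\<close>
  the cylinder stays within \<open>1 / den w 0 ^ 2\<close> of \<open>Theta w 0\<close>. Closed balls
  also retain the limit points.\<close>

lemma cf_cantor_cover:
  "cf_cantor M \<subseteq> (\<Union>w\<in>words n. cball (Theta w 0) (1 / den w 0 ^ 2))"
proof
  fix x assume "x \<in> cf_cantor M"
  then obtain a where a: "\<And>i. a i \<in> M" and lim: "(\<lambda>n. conv (map a [0..<n])) \<longlonglongrightarrow> x"
    by (auto simp: cf_cantor_def)
  define w where "w = map a [0..<n]"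
  have w: "w \<in> words n" "set w \<subseteq> M" using a by (auto simp: words_def w_def)
  have "conv (map a [0..<k + n]) \<in> cball (Theta w 0) (1 / den w 0 ^ 2)" for k
  proof -
    define y where "y = Theta (map a [n..<n + k]) 0"
    have "0 \<notin> set (map a [n..<n + k])" using a zero_notin_M by (metis ex_map_conv)
    hence y: "y \<in> {0..1}" unfolding y_def by (rule Theta_unit) simp
    have e: "conv (map a [0..<k + n]) = Theta w y"
      by (simp add: conv_eq_Theta upt_add_eq_append[OF le0] w_def y_def add.commute[of k])
    have pos: "den w 0 > 0" using den_pos[OF words_zero_notin[OF w(1)]] by simp
    have "0 \<le> slope w * y" using den_affine(2)[OF w(2)] y by simp
    hence "den w 0 \<le> den w y" using den_affine(1)[OF w(2) y] by simp
    hence "\<bar>0 - y\<bar> / (den w 0 * den w y) \<le> 1 / (den w 0 * den w 0)"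
      using pos y by (intro frac_le mult_left_mono) auto
    hence "\<bar>Theta w 0 - Theta w y\<bar> \<le> 1 / den w 0 ^ 2"
      using Theta_diff[OF words_zero_notin[OF w(1)] _ y, of 0] by (simp add: power2_eq_square)
    thus ?thesis by (simp add: e dist_real_def)
  qed
  hence "x \<in> cball (Theta w 0) (1 / den w 0 ^ 2)"
    by (intro closed_sequentially[OF closed_cball _ LIMSEQ_ignore_initial_segment[OF lim, of n]]) blast
  thus "x \<in> (\<Union>w\<in>words n. cball (Theta w 0) (1 / den w 0 ^ 2))" using w by blast
qed

lemma hausdorff_measure_zero:
  assumes t: "t > 0" and lam1: "lam t < 1"
  shows "hausdorff_measure t (cf_cantor M) = 0"
proof -
  obtain K where K: "K > 0" "\<And>n x. x \<in> {0..1} \<Longrightarrow> (\<Sum>w\<in>words n. den w x powr (-2 * t)) \<le> K * lam t ^ n"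
    using den_sum_bounds[OF t] by metis
  have "hausdorff_pre t \<delta> (cf_cantor M) \<le> ennreal e" if "\<delta> > 0" "e > 0" for \<delta> e
  proof -
    \<comment> \<open>The ball of a word has diameter \<open>2 / den w 0 ^ 2\<close>, and
      \<open>den w 0 \<ge> (3/2) ^ n / 2\<close>.\<close>
    have "(\<lambda>n. 8 * (4/9 :: real) ^ n) \<longlonglongrightarrow> 8 * 0"
      by (intro tendsto_mult tendsto_const LIMSEQ_power_zero) auto
    moreover have "(\<lambda>n. 2 powr t * (K * lam t ^ n)) \<longlonglongrightarrow> 2 powr t * (K * 0)"
      using lam1 lam_pos[OF t] by (intro tendsto_mult tendsto_const LIMSEQ_power_zero) auto
    ultimately have "eventually (\<lambda>n. 8 * (4/9 :: real) ^ n < \<delta> \<and> 2 powr t * (K * lam t ^ n) < e) sequentially"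
      using that by (intro eventually_conj order_tendstoD(2)) auto
    then obtain n where n: "8 * (4/9 :: real) ^ n < \<delta>" "2 powr t * (K * lam t ^ n) < e"
      by (auto simp: eventually_sequentially)
    let ?U = "\<lambda>w. cball (Theta w 0) (1 / den w 0 ^ 2)"
    have pos: "den w 0 > 0" if "w \<in> words n" for w using den_pos[OF words_zero_notin[OF that]] by simp
    have diam: "diameter (?U w) = 2 / den w 0 ^ 2" for w
      by simp
    have *: "hausdorff_pre t \<delta> (cf_cantor M) \<le> ennreal (\<Sum>w\<in>words n. diameter (?U w) powr t)"
    proof (rule hausdorff_pre_le[OF finite_words cf_cantor_cover])
      fix w assume w: "w \<in> words n"
      have "((3/2) ^ n) ^ 2 \<le> (2 * den w 0) ^ 2"
        using den_lower[OF w, of 0] by (intro power_mono) auto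
      moreover have "((3/2 :: real) ^ n) ^ 2 = ((3/2) ^ 2) ^ n" by (metis power_mult mult.commute)
      hence "((3/2 :: real) ^ n) ^ 2 = (9/4) ^ n" by (simp add: power2_eq_square)
      ultimately have "(9/4) ^ n \<le> 4 * den w 0 ^ 2" by (simp add: power_mult_distrib)
      hence "2 / den w 0 ^ 2 \<le> 8 * (4/9) ^ n"
        using pos[OF w] by (simp add: field_simps power_divide)
      thus "diameter (?U w) \<le> \<delta>" using n(1) unfolding diam by linarith
    qed (use that in auto)
    have "(\<Sum>w\<in>words n. diameter (?U w) powr t) = 2 powr t * (\<Sum>w\<in>words n. den w 0 powr (-2 * t))"
      unfolding sum_distrib_left
    proof (rule sum.cong[OF refl])
      fix w assume w: "w \<in> words n"
      have "(den w 0 ^ 2) powr t = den w 0 powr (2 * t)"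
        using pos[OF w] by (rule powr_square)
      thus "diameter (?U w) powr t = 2 powr t * den w 0 powr (-2 * t)"
        unfolding diam using pos[OF w] by (simp add: powr_divide powr_minus field_simps)
    qed
    also have "\<dots> \<le> 2 powr t * (K * lam t ^ n)"
      using K(2)[of 0 n] by (intro mult_left_mono) auto
    finally have "(\<Sum>w\<in>words n. diameter (?U w) powr t) \<le> e" using n(2) by linarith
    with *  show ?thesis by (meson ennreal_leI order_trans)
  qed
  hence le: "hausdorff_pre t \<delta> (cf_cantor M) \<le> 0 + ennreal e" if "\<delta> > 0" "e > 0" for \<delta> e
    using that by simp
  have "hausdorff_pre t \<delta> (cf_cantor M) \<le> 0" if "\<delta> > 0" for \<delta>
    by (rule ennreal_le_epsilon) (rule le[OF that])
  hence "hausdorff_measure t (cf_cantor M) \<le> 0"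
    unfolding hausdorff_measure_def by (rule SUP_least) simp
  thus ?thesis by simp
qed

section \<open>Separation of cylinders and the lower bound for the dimension\<close>

text \<open>Tails of points of the Cantor set stay in this interval, away from the end points of
  \<open>[0,1]\<close>, so the images of it under different branches are separated.\<close>

definition core :: "real set" where
  "core = {1 / (real (Max M) + 1) .. (real (Max M) + 1) / (real (Max M) + 2)}"

lemma core_unit: "x \<in> core \<Longrightarrow> x \<in> {0..1}"
proof -
  assume x: "x \<in> core"
  have "0 \<le> 1 / (real (Max M) + 1)" "(real (Max M) + 1) / (real (Max M) + 2) \<le> 1" by (auto simp: field_simps)
  thus "x \<in> {0..1}" using x unfolding core_def atLeastAtMost_iff by linarith
qed

text \<open>The lower end bounds every branch from below on the unit interval; the upper end is
  \<open>1 / (1 / (Max M + 1) + 1)\<close>, which bounds every branch from above at points not below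
  the lower end.\<close>

lemma theta_core:
  assumes "m \<in> M" "x \<in> core"
  shows "theta m x \<in> core"
proof -
  note m = M_bounds[OF assms(1)]
  define N where "N = real (Max M)"
  have N: "real m \<le> N" "N \<ge> 1" using m by (auto simp: N_def)
  have x: "1 / (N + 1) \<le> x" "x \<le> 1"
    using assms(2) core_unit[OF assms(2)] by (auto simp: core_def N_def)
  have x0: "x > 0" using x(1) N(2) by (meson add_pos_pos divide_pos_pos less_le_trans zero_less_one)
  have "1 / (N + 1) \<le> 1 / (x + real m)" using x x0 m N by (intro divide_left_mono) auto
  moreover have "1 / (x + real m) \<le> 1 / (1 / (N + 1) + 1)"
    using x x0 m N by (intro divide_left_mono mult_pos_pos add_mono) (auto intro: add_pos_pos)
  moreover have "1 / (1 / (N + 1) + 1) = (N + 1) / (N + 2)" using N by (simp add: field_simps)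
  ultimately show ?thesis by (simp add: core_def theta_def N_def)
qed

lemma Theta_core: "set w \<subseteq> M \<Longrightarrow> x \<in> core \<Longrightarrow> Theta w x \<in> core"
proof (induction w)
  case (Cons a w)
  hence "a \<in> M" "Theta w x \<in> core" by simp_all
  thus ?case unfolding Theta_simps by (rule theta_core)
qed simp

text \<open>On the whole unit interval neighbouring branches touch:
  \<open>theta m 1 = theta (m + 1) 0\<close>. Points of \<open>core\<close> differ by at most
  \<open>(Max M + 1) / (Max M + 2)\<close> while the digits differ by at least 1, which leaves
  \<open>1 / (Max M + 2)\<close> between the denominators.\<close>

lemma theta_separated:
  assumes "m \<in> M" "m' \<in> M" "m \<noteq> m'" "x \<in> core" "y \<in> core"
  shows "1 / ((real (Max M) + 2) * (real (Max M) + 1) ^ 2) \<le> \<bar>theta m x - theta m' y\<bar>"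
proof -
  define N where "N = real (Max M)"
  have N: "real m \<le> N" "real m' \<le> N" "real m \<ge> 1" "real m' \<ge> 1"
    using M_bounds[OF assms(1)] M_bounds[OF assms(2)] by (auto simp: N_def)
  have unit: "0 \<le> x" "x \<le> 1" "0 \<le> y" "y \<le> 1" using core_unit assms by auto
  have xy: "x \<le> (N + 1) / (N + 2)" "y \<le> (N + 1) / (N + 2)" using assms by (auto simp: core_def N_def)
  have "\<bar>real m - real m'\<bar> \<ge> 1" using assms(3) by linarith
  hence "1 - (N + 1) / (N + 2) \<le> \<bar>(y + real m') - (x + real m)\<bar>" using unit xy by linarith
  moreover have "1 - (N + 1) / (N + 2) = 1 / (N + 2)" using N by (simp add: field_simps)
  ultimately have num: "1 / (N + 2) \<le> \<bar>(y + real m') - (x + real m)\<bar>" by simp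
  have pos: "0 < x + real m" "0 < y + real m'" using unit N by auto
  have "(x + real m) * (y + real m') \<le> (N + 1) * (N + 1)" using unit N by (intro mult_mono) auto
  hence "1 / (N + 2) / ((N + 1) * (N + 1)) \<le> \<bar>(y + real m') - (x + real m)\<bar> / ((x + real m) * (y + real m'))"
    using num pos N by (intro frac_le) auto
  also have "\<dots> = \<bar>((y + real m') - (x + real m)) / ((x + real m) * (y + real m'))\<bar>"
    using pos by (simp add: abs_divide abs_mult)
  also have "((y + real m') - (x + real m)) / ((x + real m) * (y + real m')) = theta m x - theta m' y"
    using pos by (simp add: theta_def field_simps)
  finally show ?thesis by (simp add: N_def power2_eq_square)
qed

lemma Theta_diff_lower:
  assumes "set w \<subseteq> M" "x \<in> {0..1}" "y \<in> {0..1}" "z \<in> {0..1}"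
  shows "\<bar>x - y\<bar> / (4 * den w z ^ 2) \<le> \<bar>Theta w x - Theta w y\<bar>"
proof -
  have w0: "0 \<notin> set w" using assms(1) zero_notin_M by auto
  have pos: "den w x > 0" "den w y > 0" "den w z > 0" using den_pos[OF w0] assms by auto
  have "den w x * den w y \<le> (2 * den w z) * (2 * den w z)"
    using den_distortion[OF assms(1)] assms(2-4) pos by (intro mult_mono) auto
  hence "\<bar>x - y\<bar> / ((2 * den w z) * (2 * den w z)) \<le> \<bar>x - y\<bar> / (den w x * den w y)"
    using pos by (intro divide_left_mono) auto
  thus ?thesis unfolding Theta_diff[OF w0 assms(2,3)] by (simp add: power2_eq_square)
qed

text \<open>The two entries serve the two cases of a cluster: the separation of two distinct digits,
  and the length of \<open>core\<close> when the cluster is a single word.\<close>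

definition gap :: real where
  "gap = min (1 / ((real (Max M) + 2) * (real (Max M) + 1) ^ 2)) ((real (Max M) + 1) / (real (Max M) + 2) - 1 / (real (Max M) + 1))"

lemma gap_pos: "gap > 0"
proof -
  define N where "N = real (Max M)"
  have N: "N \<ge> 1" using Max_ge_1 by (simp add: N_def)
  have "N + 2 < (N + 1) * (N + 1)" using N mult_mono[of 1 N 1 N] by (simp add: algebra_simps)
  hence "1 / (N + 1) < (N + 1) / (N + 2)" using N by (simp add: field_simps)
  moreover have "0 < 1 / ((N + 2) * (N + 1) ^ 2)" using N by simp
  ultimately show ?thesis unfolding gap_def N_def by simp
qed

lemma core_ends: "1 / (real (Max M) + 1) \<in> core" "(real (Max M) + 1) / (real (Max M) + 2) \<in> core"
proof -
  have "1 / (real (Max M) + 1) \<le> (real (Max M) + 1) / (real (Max M) + 2)"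
    using gap_pos unfolding gap_def min_less_iff_conj by linarith
  thus "1 / (real (Max M) + 1) \<in> core" "(real (Max M) + 1) / (real (Max M) + 2) \<in> core"
    unfolding core_def atLeastAtMost_iff by blast+
qed

text \<open>The mass distribution estimate: cylinders of one generation that lie close together share a
  prefix \<open>u\<close> whose cylinder has comparable diameter.\<close>

lemma cluster_prefix:
  assumes W: "W \<subseteq> words n" "W \<noteq> {}" and z: "z \<in> {0..1}"
    and close: "\<And>w w' x y. w \<in> W \<Longrightarrow> w' \<in> W \<Longrightarrow> x \<in> core \<Longrightarrow> y \<in> core \<Longrightarrow> \<bar>Theta w x - Theta w' y\<bar> \<le> d"
  obtains u where "set u \<subseteq> M" "length u \<le> n" "W \<subseteq> (\<lambda>v. u @ v) ` words (n - length u)"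
    "1 / den u z ^ 2 \<le> 4 * d / gap"
proof -
  have len: "length w = n" "set w \<subseteq> M" if "w \<in> W" for w using W that by (auto simp: words_def)
  obtain u where u: "\<forall>w\<in>W. \<exists>v. w = u @ v"
    "W = {u} \<or> (\<exists>a b v v'. a \<noteq> b \<and> u @ a # v \<in> W \<and> u @ b # v' \<in> W)"
    using common_prefix[OF W(2) len(1)] by blast
  obtain w0 where w0: "w0 \<in> W" using W by auto
  from u(1) w0 obtain v0 where "w0 = u @ v0" by blast
  hence uM: "set u \<subseteq> M" "length u \<le> n" using len[OF w0] by auto
  have pos: "den u z > 0" using den_pos[of u z] uM z zero_notin_M by auto
  have "gap / (4 * den u z ^ 2) \<le> d"
    using u(2)
  proof
    assume "W = {u}"
    hence u: "u \<in> W" by simp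
    have "gap / (4 * den u z ^ 2) \<le> \<bar>1 / (real (Max M) + 1) - (real (Max M) + 1) / (real (Max M) + 2)\<bar> / (4 * den u z ^ 2)"
      by (intro divide_right_mono) (auto simp: gap_def)
    also have "\<dots> \<le> \<bar>Theta u (1 / (real (Max M) + 1)) - Theta u ((real (Max M) + 1) / (real (Max M) + 2))\<bar>"
      by (rule Theta_diff_lower[OF uM(1) core_unit core_unit z]) (rule core_ends)+
    also have "\<dots> \<le> d" by (rule close[OF u u core_ends])
    finally show ?thesis .
  next
    assume "\<exists>a b v v'. a \<noteq> b \<and> u @ a # v \<in> W \<and> u @ b # v' \<in> W"
    then obtain a b v v' where ab: "a \<noteq> b" "u @ a # v \<in> W" "u @ b # v' \<in> W" by blast
    let ?x = "Theta v (1 / (real (Max M) + 1))" and ?y = "Theta v' (1 / (real (Max M) + 1))"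
    have M: "a \<in> M" "b \<in> M" "set v \<subseteq> M" "set v' \<subseteq> M" using len(2)[OF ab(2)] len(2)[OF ab(3)] by auto
    have core: "?x \<in> core" "?y \<in> core" using Theta_core M core_ends by auto
    have "gap / (4 * den u z ^ 2) \<le> \<bar>theta a ?x - theta b ?y\<bar> / (4 * den u z ^ 2)"
      using theta_separated[OF M(1,2) ab(1) core] by (intro divide_right_mono) (auto simp: gap_def)
    also have "\<dots> \<le> \<bar>Theta u (theta a ?x) - Theta u (theta b ?y)\<bar>"
      by (rule Theta_diff_lower[OF uM(1) core_unit core_unit z]) (rule theta_core M core)+
    also have "\<dots> \<le> d" using close[OF ab(2,3) core_ends(1) core_ends(1)] by simp
    finally show ?thesis .
  qed
  hence "1 / den u z ^ 2 \<le> 4 * d / gap" using gap_pos pos by (simp add: field_simps)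
  moreover have "W \<subseteq> (\<lambda>v. u @ v) ` words (n - length u)"
  proof
    fix w assume w: "w \<in> W"
    then obtain v where v: "w = u @ v" using u(1) by blast
    thus "w \<in> (\<lambda>v. u @ v) ` words (n - length u)" using len[OF w] by (auto simp: words_def)
  qed
  ultimately show ?thesis using that uM by blast
qed

text \<open>A Frostman estimate for the weights \<open>den w z powr (-2 * t) / lam t ^ n\<close>. By
  \<open>den_append\<close> and distortion the weight below the common prefix \<open>u\<close>
  splits off \<open>den u z powr (-2 * t)\<close>, of order at most \<open>d powr t\<close>;
  \<open>lam t \<ge> 1\<close> absorbs the missing \<open>length u\<close> generations.\<close>

lemma cluster_mass:
  assumes t: "t > 0" and lam1: "lam t \<ge> 1"
  obtains C where "C > 0" "\<And>n W d z. W \<subseteq> words n \<Longrightarrow> z \<in> {0..1} \<Longrightarrow> d > 0 \<Longrightarrow>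
     (\<And>w w' x y. w \<in> W \<Longrightarrow> w' \<in> W \<Longrightarrow> x \<in> core \<Longrightarrow> y \<in> core \<Longrightarrow> \<bar>Theta w x - Theta w' y\<bar> \<le> d) \<Longrightarrow>
     (\<Sum>w\<in>W. den w z powr (-2 * t)) \<le> C * lam t ^ n * d powr t"
proof -
  obtain K where K: "K > 0" "\<And>n x. x \<in> {0..1} \<Longrightarrow> (\<Sum>w\<in>words n. den w x powr (-2 * t)) \<le> K * lam t ^ n"
    using den_sum_bounds[OF t] by metis
  define C where "C = 2 powr (2 * t) * (4 / gap) powr t * K"
  show ?thesis
  proof (rule that[of C])
    show "C > 0" using K gap_pos by (simp add: C_def)
    fix n W d z assume W: "W \<subseteq> words n" and z: "z \<in> {0..1::real}" and d: "d > (0::real)"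
      and close: "\<And>w w' x y. w \<in> W \<Longrightarrow> w' \<in> W \<Longrightarrow> x \<in> core \<Longrightarrow> y \<in> core \<Longrightarrow> \<bar>Theta w x - Theta w' y\<bar> \<le> d"
    show "(\<Sum>w\<in>W. den w z powr (-2 * t)) \<le> C * lam t ^ n * d powr t"
    proof (cases "W = {}")
      case True
      thus ?thesis using \<open>C > 0\<close> lam1 by simp
    next
      case False
      obtain u where u: "set u \<subseteq> M" "length u \<le> n" "W \<subseteq> (\<lambda>v. u @ v) ` words (n - length u)"
        "1 / den u z ^ 2 \<le> 4 * d / gap"
        using cluster_prefix[OF W False z close] .
      have pos: "den u x > 0" if "x \<in> {0..1}" for x using den_pos[of u x] u(1) that zero_notin_M by auto
      have "(1 / den u z ^ 2) powr t \<le> (4 * d / gap) powr t" using u(4) t by (intro powr_mono2) auto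
      moreover have "(1 / den u z ^ 2) powr t = den u z powr (-2 * t)"
      proof -
        have "(den u z ^ 2) powr t = den u z powr (2 * t)"
          using pos[OF z] by (rule powr_square)
        thus ?thesis using pos[OF z] by (simp add: powr_divide powr_minus field_simps)
      qed
      moreover have "(4 * d / gap) powr t = (4 / gap) powr t * d powr t"
        by (simp add: powr_divide powr_mult)
      ultimately have du: "den u z powr (-2 * t) \<le> (4 / gap) powr t * d powr t" by simp
      have "(\<Sum>w\<in>W. den w z powr (-2 * t)) \<le> (\<Sum>w\<in>(\<lambda>v. u @ v) ` words (n - length u). den w z powr (-2 * t))"
        using u(3) finite_words by (intro sum_mono2) auto
      also have "\<dots> = (\<Sum>v\<in>words (n - length u). den (u @ v) z powr (-2 * t))"
        by (subst sum.reindex) (auto intro: inj_onI)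
      also have "\<dots> \<le> (\<Sum>v\<in>words (n - length u). 2 powr (2 * t) * den u z powr (-2 * t) * den v z powr (-2 * t))"
      proof (rule sum_mono)
        fix v assume v: "v \<in> words (n - length u)"
        have y: "Theta v z \<in> {0..1}" by (rule Theta_unit[OF words_zero_notin[OF v] z])
        have "u \<in> words (length u)" using u(1) by (simp add: words_def)
        from den_powr_distortion[OF this y z, of t] t
        have "den u (Theta v z) powr (-2 * t) \<le> 2 powr (2 * t) * den u z powr (-2 * t)" by simp
        thus "den (u @ v) z powr (-2 * t) \<le> 2 powr (2 * t) * den u z powr (-2 * t) * den v z powr (-2 * t)"
          unfolding den_append powr_mult by (intro mult_right_mono) auto
      qed
      also have "\<dots> = 2 powr (2 * t) * den u z powr (-2 * t) * (\<Sum>v\<in>words (n - length u). den v z powr (-2 * t))"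
        by (simp add: sum_distrib_left)
      also have "\<dots> \<le> 2 powr (2 * t) * ((4 / gap) powr t * d powr t) * (K * lam t ^ n)"
      proof (intro mult_mono)
        have "(\<Sum>v\<in>words (n - length u). den v z powr (-2 * t)) \<le> K * lam t ^ (n - length u)" by (rule K(2)[OF z])
        also have "\<dots> \<le> K * lam t ^ n" using K(1) lam1 by (intro mult_left_mono power_increasing) auto
        finally show "(\<Sum>v\<in>words (n - length u). den v z powr (-2 * t)) \<le> K * lam t ^ n" .
      qed (use du in \<open>auto intro: sum_nonneg\<close>)
      finally show ?thesis by (simp add: C_def mult_ac)
    qed
  qed
qed

lemma hausdorff_measure_nonzero:
  assumes t: "t > 0" and lam1: "lam t \<ge> 1"
  shows "hausdorff_measure t (cf_cantor M) \<noteq> 0"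
proof -
  obtain K where K: "K > 0" "\<And>n x. x \<in> {0..1} \<Longrightarrow> lam t ^ n \<le> K * (\<Sum>w\<in>words n. den w x powr (-2 * t))"
    using den_sum_bounds[OF t] by metis
  obtain C where C: "C > 0" "\<And>n W d z. W \<subseteq> words n \<Longrightarrow> z \<in> {0..1} \<Longrightarrow> d > 0 \<Longrightarrow>
     (\<And>w w' x y. w \<in> W \<Longrightarrow> w' \<in> W \<Longrightarrow> x \<in> core \<Longrightarrow> y \<in> core \<Longrightarrow> \<bar>Theta w x - Theta w' y\<bar> \<le> d) \<Longrightarrow>
     (\<Sum>w\<in>W. den w z powr (-2 * t)) \<le> C * lam t ^ n * d powr t"
    using cluster_mass[OF t lam1] by metis
  \<comment> \<open>With this value the final inequality reads \<open>1 < 1 / 2\<close>.\<close>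
  define c where "c = 1 / (4 * K * C * 2 powr t)"
  have c: "c > 0" using K C by (simp add: c_def)
  have "ennreal c \<le> (\<Sum>i. ennreal (diameter (U i) powr t))"
    if cover: "cf_cantor M \<subseteq> (\<Union>i. U i)" and bdd: "\<And>i. bounded (U i)" for U
  proof (rule ccontr)
    assume "\<not> ?thesis"
    hence less: "(\<Sum>i. ennreal (diameter (U i) powr t)) < ennreal c" by simp
    define d where "d = (\<lambda>i. diameter (U i))"
    have d0: "d i \<ge> 0" for i unfolding d_def using diameter_ge_0[OF bdd] .
    \<comment> \<open>The enlargements are positive even for diameter \<open>0\<close>, and their
      costs sum to at most \<open>c\<close>.\<close>
    have "\<exists>\<eta>>0. (d i + \<eta>) powr t \<le> d i powr t + c * (1/2) ^ Suc i" for i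
      using powr_enlarge[OF d0 t, of "c * (1/2) ^ Suc i"] c by (metis mult_pos_pos zero_less_power half_gt_zero zero_less_one)
    then obtain \<eta> where \<eta>: "\<And>i. \<eta> i > 0" "\<And>i. (d i + \<eta> i) powr t \<le> d i powr t + c * (1/2) ^ Suc i"
      by metis
    define r where "r = (\<lambda>i. d i + \<eta> i)"
    have r: "r i > 0" for i using d0 \<eta>(1) by (simp add: r_def add_nonneg_pos)
    \<comment> \<open>For an empty \<open>U i\<close> the centre is arbitrary; membership of
      \<open>p i\<close> in \<open>U i\<close> is claimed only once a point of \<open>U i\<close> is
      given.\<close>
    define p where "p = (\<lambda>i. SOME x. x \<in> U i)"
    define P where "P = (\<lambda>w. \<exists>i. \<forall>y\<in>{0..1}. Theta w y \<in> ball (p i) (r i))"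
    have "\<exists>n. \<forall>w\<in>words n. P w"
    proof (rule bar_induction)
      fix u v assume P: "P u" and v: "set v \<subseteq> M"
      have "0 \<notin> set v" using v zero_notin_M by auto
      thus "P (u @ v)" using P unfolding P_def by (metis Theta_simps(3) Theta_unit)
    next
      fix a :: "nat \<Rightarrow> nat" assume a: "\<And>i. a i \<in> M"
      obtain x where x: "x \<in> cf_cantor M"
        "\<And>n y. y \<in> {0..1} \<Longrightarrow> \<bar>x - Theta (map a [0..<n]) y\<bar> \<le> 4 * (4/9) ^ n"
        using cf_point[of a, OF a] by blast
      obtain i where i: "x \<in> U i" using x(1) cover by auto
      hence "p i \<in> U i" unfolding p_def by (rule someI)
      hence pi: "dist (p i) x \<le> d i" unfolding d_def using i by (intro diameter_bounded_bound bdd)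
      have "(\<lambda>n. 4 * (4/9 :: real) ^ n) \<longlonglongrightarrow> 4 * 0"
        by (intro tendsto_mult tendsto_const LIMSEQ_power_zero) auto
      from order_tendstoD(2)[OF this, of "\<eta> i"] obtain n where n: "4 * (4/9 :: real) ^ n < \<eta> i"
        using \<eta>(1)[of i] by (auto simp: eventually_sequentially)
      have "Theta (map a [0..<n]) y \<in> ball (p i) (r i)" if "y \<in> {0..1}" for y
        using x(2)[OF that, of n] n pi unfolding mem_ball r_def dist_real_def by linarith
      thus "\<exists>n. P (map a [0..<n])" unfolding P_def by blast
    qed
    then obtain n where "\<forall>w\<in>words n. \<exists>i. \<forall>y\<in>{0..1}. Theta w y \<in> ball (p i) (r i)"
      unfolding P_def by blast
    then obtain i where i: "\<And>w y. w \<in> words n \<Longrightarrow> y \<in> {0..1} \<Longrightarrow> Theta w y \<in> ball (p (i w)) (r (i w))"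
      by metis
    \<comment> \<open>One generation uses only finitely many balls. Its words are grouped by the
      ball chosen to contain their cylinder, and \<open>cluster_mass\<close> bounds each
      group.\<close>
    define I where "I = i ` words n"
    have I: "finite I" unfolding I_def using finite_words by simp
    have "1 * lam t ^ n \<le> K * (\<Sum>w\<in>words n. den w 0 powr (-2 * t))" using K(2)[of 0 n] by simp
    also have "(\<Sum>w\<in>words n. den w 0 powr (-2 * t)) =
        (\<Sum>j\<in>I. \<Sum>w\<in>{w \<in> words n. i w = j}. den w 0 powr (-2 * t))"
      unfolding I_def using sum.image_gen[OF finite_words] .
    also have "\<dots> \<le> (\<Sum>j\<in>I. C * lam t ^ n * (2 * r j) powr t)"
    proof (rule sum_mono)
      fix j assume "j \<in> I"
      show "(\<Sum>w\<in>{w \<in> words n. i w = j}. den w 0 powr (-2 * t)) \<le> C * lam t ^ n * (2 * r j) powr t"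
      proof (rule C(2))
        fix w w' x y assume w: "w \<in> {w \<in> words n. i w = j}" "w' \<in> {w \<in> words n. i w = j}" "x \<in> core" "y \<in> core"
        have "Theta w x \<in> ball (p j) (r j)" "Theta w' y \<in> ball (p j) (r j)"
          using i[of w x] i[of w' y] w core_unit by auto
        thus "\<bar>Theta w x - Theta w' y\<bar> \<le> 2 * r j" unfolding mem_ball dist_real_def by linarith
      qed (use r in auto)
    qed
    also have "\<dots> = C * lam t ^ n * 2 powr t * (\<Sum>j\<in>I. r j powr t)"
      by (simp add: sum_distrib_left powr_mult mult_ac)
    also have "(\<Sum>j\<in>I. r j powr t) < 2 * c"
    proof -
      have "(\<Sum>j\<in>I. ennreal (d j powr t)) \<le> (\<Sum>i. ennreal (diameter (U i) powr t))"
        unfolding d_def by (rule sum_le_suminf) (use I in auto)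
      hence "ennreal (\<Sum>j\<in>I. d j powr t) < ennreal c" using less by simp
      hence "(\<Sum>j\<in>I. d j powr t) < c" using c by (simp add: ennreal_less_iff sum_nonneg)
      moreover have "(\<Sum>j\<in>I. (1/2 :: real) ^ Suc j) \<le> (\<Sum>j. (1/2) ^ Suc j)"
        by (rule sum_le_suminf) (use I sums_summable[OF power_half_series] in auto)
      hence "(\<Sum>j\<in>I. (1/2 :: real) ^ Suc j) \<le> 1" using sums_unique[OF power_half_series] by simp
      hence "c * (\<Sum>j\<in>I. (1/2 :: real) ^ Suc j) \<le> c * 1" using c by (intro mult_left_mono) auto
      moreover have "(\<Sum>j\<in>I. r j powr t) \<le> (\<Sum>j\<in>I. d j powr t + c * (1/2) ^ Suc j)"
        unfolding r_def by (intro sum_mono \<eta>(2))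
      ultimately show ?thesis unfolding sum.distrib sum_distrib_left[symmetric] by linarith
    qed
    finally have "1 * lam t ^ n < K * (C * lam t ^ n * 2 powr t * (2 * c))"
      using K(1) C(1) lam1 by simp
    hence "1 < K * C * 2 powr t * 2 * c" using lam1 by (simp add: field_simps)
    thus False using K C by (simp add: c_def)
  qed
  \<comment> \<open>The bound holds for covers of any mesh, and the measure is a supremum over
    scales, so a single scale suffices.\<close>
  hence "ennreal c \<le> hausdorff_pre t 1 (cf_cantor M)"
    unfolding hausdorff_pre_def by (intro INF_greatest) auto
  also have "\<dots> \<le> hausdorff_measure t (cf_cantor M)"
    unfolding hausdorff_measure_def by (rule SUP_upper) simp
  finally show ?thesis using c by (auto simp: ennreal_eq_0_iff)
qed

text \<open>The exponents of measure zero are exactly those with \<open>lam t < 1\<close>, which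
  strict monotonicity turns into an open half-line starting at \<open>s\<close>.\<close>

lemma hausdorff_dim_cf_cantor:
  assumes s: "s > 0" "lam s = 1"
  shows "hausdorff_dim (cf_cantor M) = s"
proof -
  have "{t. t > 0 \<and> hausdorff_measure t (cf_cantor M) = 0} = {s<..}"
  proof (intro set_eqI iffI)
    fix t assume "t \<in> {t. t > 0 \<and> hausdorff_measure t (cf_cantor M) = 0}"
    hence "t > 0" "\<not> lam t \<ge> 1" using hausdorff_measure_nonzero by auto
    thus "t \<in> {s<..}" using monotone_onD[OF lam_strict_antimono, of t s] s by (cases t s rule: linorder_cases) auto
  next
    fix t assume "t \<in> {s<..}"
    thus "t \<in> {t. t > 0 \<and> hausdorff_measure t (cf_cantor M) = 0}"
      using monotone_onD[OF lam_strict_antimono, of s t] s hausdorff_measure_zero[of t] by auto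
  qed
  thus ?thesis by (simp add: hausdorff_dim_def)
qed

end

theorem theorem3p1:
  fixes M :: "nat set"
  assumes fin: "finite M" and ne: "M \<noteq> {}" and pos: "0 \<notin> M"
  defines "\<gamma> \<equiv> Min M"
  defines "lam \<equiv> spectral_radius_L M"
  shows
   "(\<forall>s>0. \<exists>v. continuous_on {0..1} v \<and> (\<forall>x\<in>{0..1}. v x > 0) \<and> lam s > 0 \<and>
        (\<forall>x\<in>{0..1}. Lop M s v x = lam s * v x) \<and>
        (\<forall>w \<mu>. continuous_on {0..1} w \<and> (\<forall>x\<in>{0..1}. w x > 0) \<and>
               (\<forall>x\<in>{0..1}. Lop M s w x = \<mu> * w x)
           \<longrightarrow> (\<exists>c>0. \<forall>x\<in>{0..1}. w x = c * v x)) \<and>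
        (\<exists>D :: nat \<Rightarrow> real \<Rightarrow> real. (\<forall>x\<in>{0..1}. D 0 x = v x) \<and>
           (\<forall>k. \<forall>x\<in>{0..1}. (D k has_real_derivative D (Suc k) x) (at x within {0..1})) \<and>
           (\<forall>k\<ge>1. \<forall>x\<in>{0..1}. (-1) ^ k * D k x > 0 \<and>
                \<bar>D k x\<bar> \<le> pochhammer (2 * s) k * real \<gamma> powr (- real k) * v x)))
    \<and> strict_antimono_on {0<..} lam
    \<and> continuous_on {0<..} lam
    \<and> (card M \<ge> 2 \<longrightarrow>
         (\<exists>s>0. lam s = 1 \<and> (\<forall>t>0. lam t = 1 \<longrightarrow> t = s) \<and>
                hausdorff_dim (cf_cantor M) = s))"
proof -
  interpret digits M by unfold_locales (use fin ne pos in auto)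
  have eigen: "\<exists>v. continuous_on {0..1} v \<and> (\<forall>x\<in>{0..1}. v x > 0) \<and> lam s > 0 \<and>
        (\<forall>x\<in>{0..1}. Lop M s v x = lam s * v x) \<and>
        (\<forall>w \<mu>. continuous_on {0..1} w \<and> (\<forall>x\<in>{0..1}. w x > 0) \<and>
               (\<forall>x\<in>{0..1}. Lop M s w x = \<mu> * w x)
           \<longrightarrow> (\<exists>c>0. \<forall>x\<in>{0..1}. w x = c * v x)) \<and>
        (\<exists>D :: nat \<Rightarrow> real \<Rightarrow> real. (\<forall>x\<in>{0..1}. D 0 x = v x) \<and>
           (\<forall>k. \<forall>x\<in>{0..1}. (D k has_real_derivative D (Suc k) x) (at x within {0..1})) \<and>
           (\<forall>k\<ge>1. \<forall>x\<in>{0..1}. (-1) ^ k * D k x > 0 \<and>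
                \<bar>D k x\<bar> \<le> pochhammer (2 * s) k * real \<gamma> powr (- real k) * v x))"
    if s: "s > 0" for s
  proof -
    obtain \<rho> and D :: "nat \<Rightarrow> real \<Rightarrow> real" where D: "\<And>x. x \<in> {0..1} \<Longrightarrow> D 0 x > 0"
      "\<And>x. x \<in> {0..1} \<Longrightarrow> Lop M s (D 0) x = \<rho> * D 0 x"
      "\<And>k x. x \<in> {0..1} \<Longrightarrow> (D k has_real_derivative D (Suc k) x) (at x within {0..1})"
      and lo: "\<And>k x. x \<in> {0..1} \<Longrightarrow>
         pochhammer (2 * s) k * (1 / real (Max M + 2)) ^ k * D 0 x \<le> (-1) ^ k * D k x"
      and up: "\<And>k x. x \<in> {0..1} \<Longrightarrow>
         (-1) ^ k * D k x \<le> pochhammer (2 * s) k * (1 / real (Min M)) ^ k * D 0 x"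
      using eigenvector_exists[OF s] by metis
    have cont: "continuous_on {0..1} (D 0)" using D(3) by (rule DERIV_continuous_on)
    have lam: "lam s = \<rho>" unfolding lam_def by (rule spectral_radius_eq[OF cont D(1,2)])
    have sign: "(-1) ^ k * D k x > 0" if x: "x \<in> {0..1}" for k x
    proof -
      have "0 < pochhammer (2 * s) k * (1 / real (Max M + 2)) ^ k * D 0 x"
        using s D(1)[OF x] by (intro mult_pos_pos pochhammer_pos zero_less_power) auto
      thus ?thesis using lo[OF x, of k] by linarith
    qed
    have bound: "\<bar>D k x\<bar> \<le> pochhammer (2 * s) k * real \<gamma> powr (- real k) * D 0 x"
      if x: "x \<in> {0..1}" for k x
    proof -
      have "\<bar>D k x\<bar> = \<bar>(-1) ^ k * D k x\<bar>" by (simp add: abs_mult)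
      also have "\<dots> = (-1) ^ k * D k x" using sign[OF x] by (simp only: abs_of_pos)
      also have "\<dots> \<le> pochhammer (2 * s) k * (1 / real (Min M)) ^ k * D 0 x" by (rule up[OF x])
      also have "(1 / real (Min M)) ^ k = real \<gamma> powr (- real k)"
        using Min_ge_1 by (simp add: \<gamma>_def powr_minus powr_realpow power_one_over inverse_eq_divide)
      finally show ?thesis .
    qed
    show ?thesis
    proof (rule exI[of _ "D 0"], intro conjI allI impI)
      show "lam s > 0" unfolding lam by (rule eigenvalue_pos[OF cont D(1,2)])
      show "\<exists>c>0. \<forall>x\<in>{0..1}. w x = c * D 0 x"
        if "continuous_on {0..1} w \<and> (\<forall>x\<in>{0..1}. w x > 0) \<and> (\<forall>x\<in>{0..1}. Lop M s w x = \<mu> * w x)" for w \<mu>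
        by (rule positive_eigenvector_unique[OF cont D(1,2)]) (use that in blast)+
      show "\<exists>E :: nat \<Rightarrow> real \<Rightarrow> real. (\<forall>x\<in>{0..1}. E 0 x = D 0 x) \<and>
           (\<forall>k. \<forall>x\<in>{0..1}. (E k has_real_derivative E (Suc k) x) (at x within {0..1})) \<and>
           (\<forall>k\<ge>1. \<forall>x\<in>{0..1}. (-1) ^ k * E k x > 0 \<and>
                \<bar>E k x\<bar> \<le> pochhammer (2 * s) k * real \<gamma> powr (- real k) * D 0 x)"
        using D(3) sign bound by blast
    qed (use cont D(1,2) lam in blast)+
  qed
  have dim: "\<exists>s>0. lam s = 1 \<and> (\<forall>t>0. lam t = 1 \<longrightarrow> t = s) \<and> hausdorff_dim (cf_cantor M) = s"
    if card: "card M \<ge> 2"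
  proof -
    obtain s where s: "s > 0" "lam s = 1" using lam_eq_1_exists[OF card] unfolding lam_def .
    have "t = s" if "t > 0" "lam t = 1" for t
      using monotone_onD[OF lam_strict_antimono, of s t] monotone_onD[OF lam_strict_antimono, of t s] s that
      unfolding lam_def by (cases t s rule: linorder_cases) auto
    thus ?thesis using s hausdorff_dim_cf_cantor[of s] unfolding lam_def by blast
  qed
  show ?thesis
    using eigen dim lam_strict_antimono lam_continuous unfolding lam_def by blast
qed

end
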